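(* Let $n\ge 1$, let $J\in\mathcal J$, $H\in\mathcal H$, and let $\mathbf u=\{u^1,\dots,u^n\}\in\mathcal M^{J,H}$. Then $\mathrm{Cross}(\mathbf u(s,\cdot))$ is, when well-defined (i.e. for those $s$ with $\mathbf u(s,\cdot)\in\Omega^n$), non-increasing in $s$. More precisely, if $u^k(s_0,t_0)=u^{k'}(s_0,t_0)$ for some $(s_0,t_0)$ and some $k\neq k'$, then either there exists $\epsilon_0>0$ such that $$\mathrm{Cross}(\mathbf u(s_0-\epsilon,\cdot))>\mathrm{Cross}(\mathbf u(s_0+\epsilon,\cdot))\qquad\text{for all }0<\epsilon\le\epsilon_0$$ (whenever both sides are well-defined), or $u^k\equiv u^{k'}$.
   Context: $\mathbb D^2=\{x=(p,q)\in\mathbb R^2:|x|\le 1\}$ with $\omega_0=dp\wedge dq$. Braids. $\overline\Omega^n$ is the set of closed, possibly singular, $n$-strand braids: unordered collections $\mathbf x=\{x^1,\dots,x^n\}$ of continuous maps $x^k:\mathbb R\to\mathbb D^2$ (strands) such that for some permutation $\sigma\in S_n$, $x^k(t+1)=x^{\sigma(k)}(t)$ for all $t,k$. $\Omega^n\subset\overline\Omega^n$ is the subset with $x^k(t)\ne x^{k'}(t)$ for all $t$ and all $k\neq k'$. Crossing number. For $w:[0,1]\to\mathbb R^2\setminus\{0\}$ continuous let $W(w,0)$ be its (real-valued) winding number about $0$, i.e. $\frac1{2\pi}$ times the total change of angle ($\frac1{2\pi}\int_w\frac{-q\,dp+p\,dq}{p^2+q^2}$ for $C^1$ curves). For $\mathbf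 x\in\Omega^n$, $\mathrm{Cross}(\mathbf x)=\sum_{k\ne k'}W\big((x^k-x^{k'})|_{[0,1]},0\big)$, the sum over ordered pairs. Hamiltonians. $\mathcal H$ is the set of $H\in C^\infty(\mathbb R\times\mathbb D^2;\mathbb R)$ with $H(t+1,x)=H(t,x)$ and $H(t,x)=0$ for $x\in\partial\mathbb D^2$. $\mathcal J$ is the set of smooth, 1-periodic in $t$, families $J(t,\cdot)$ of almost complex structures on $\mathbb D^2$ ($J^2=-\mathrm{Id}$, $\omega_0(J\cdot,J\cdot)=\omega_0$, $g=\omega_0(\cdot,J\cdot)$ a metric). $\nabla_g$ is the gradient with respect to $g$. Solutions. $\mathcal M^{J,H}$ is the set of collections $\mathbf u=\{u^1,\dots,u^n\}$ of $C^1$ functions $u^k:\mathbb R\times\mathbb R\to\mathbb D^2$, $u^k=u^k(s,t)$, such that $\mathbf u(s,\cdot)\in\overline\Omega^n$ for all $s$ (i.e. $u^k(s,t+1)=u^{\sigma(k)}(s,t)$ for some $\sigma\in S_n$) and each $u^k$ satisfies the nonlinear Cauchy-Riemann equation $u_s-J(t,u)u_t-\nabla_gH(t,u)=0$. *)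

theory Defs
  imports "HOL-Complex_Analysis.Complex_Analysis" "HOL-Combinatorics.Permutations"
begin

(* The plane R^2 with coordinates (p,q) is the type complex, p + i q; the disc D^2 is cball 0 1.
   An unordered n-strand collection is given by a labelling of its strands by 1,...,n; it may
   contain repetitions, and nothing below depends on the labelling. *)

section \<open>Differentiability classes\<close>

text \<open>The set \<open>U\<close> is meant to be open.\<close>

primrec Ck_on :: "nat \<Rightarrow> ('a::euclidean_space \<Rightarrow> 'b::real_normed_vector) \<Rightarrow> 'a set \<Rightarrow> bool" where
  "Ck_on 0 f U \<longleftrightarrow> continuous_on U f"
| "Ck_on (Suc k) f U \<longleftrightarrow>
     (\<forall>x\<in>U. f differentiable (at x)) \<and> (\<forall>v. Ck_on k (\<lambda>x. frechet_derivative f (at x) v) U)"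

text \<open>On a set that is not open, smooth means: restriction of a smooth map on an open
  neighbourhood.  On \<open>\<real> \<times> \<close>disc this is smoothness up to the boundary.\<close>

definition smooth_on :: "'a::euclidean_space set \<Rightarrow> ('a \<Rightarrow> 'b::real_normed_vector) \<Rightarrow> bool" where
  "smooth_on S f \<longleftrightarrow>
     (\<exists>U F. open U \<and> S \<subseteq> U \<and> (\<forall>k. Ck_on k F U) \<and> (\<forall>x\<in>S. F x = f x))"

section \<open>Braids and the crossing number\<close>

definition singular_braids :: "nat \<Rightarrow> (nat \<Rightarrow> real \<Rightarrow> complex) set" where
  "singular_braids n = {x.
     (\<forall>k\<in>{1..n}. continuous_on UNIV (x k) \<and> range (x k) \<subseteq> cball 0 1) \<and>
     (\<exists>\<sigma>. \<sigma> permutes {1..n} \<and> (\<forall>k\<in>{1..n}. \<forall>t. x k (t + 1) = x (\<sigma> k) t))}"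

definition braids :: "nat \<Rightarrow> (nat \<Rightarrow> real \<Rightarrow> complex) set" where
  "braids n = {x \<in> singular_braids n.
     \<forall>k\<in>{1..n}. \<forall>k'\<in>{1..n}. k \<noteq> k' \<longrightarrow> (\<forall>t. x k t \<noteq> x k' t)}"

text \<open>For a path that need not be closed, \<open>winding_number w 0\<close> is the integral of
  \<open>dz / (2 \<pi> \<i> z)\<close>.  Its real part is the integral of \<open>(p dq - q dp) / (2 \<pi> (p\<^sup>2 + q\<^sup>2))\<close>,
  i.e. the normalised total change of angle (see \<open>real_winding_eq_angle\<close>); its imaginary part
  only records the change of modulus.\<close>

definition real_winding :: "(real \<Rightarrow> complex) \<Rightarrow> real" where
  "real_winding w = Re (winding_number w 0)"

lemma real_winding_eq_angle:
  assumes w: "path w" "0 \<notin> path_image w"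
    and \<theta>: "continuous_on {0..1} \<theta>"
    and lift: "\<And>t. t \<in> {0..1} \<Longrightarrow> w t = of_real (norm (w t)) * cis (\<theta> t)"
  shows "real_winding w = (\<theta> 1 - \<theta> 0) / (2 * pi)"
proof -
  define q where "q t = Complex (ln (norm (w t))) (\<theta> t)" for t
  have nz: "w t \<noteq> 0" if "t \<in> {0..1}" for t
    using w(2) that by (auto simp: path_image_def)
  have "continuous_on {0..1} w" using w(1) by (simp add: path_def)
  then have "path q"
    unfolding path_def q_def Complex_eq using nz \<theta>
    by (intro continuous_intros) auto
  have "winding_number w 0 = winding_number (exp \<circ> q) 0"
  proof (rule winding_number_cong)
    fix t :: real assume "0 \<le> t" "t \<le> 1"
    then show "w t = (exp \<circ> q) t"
      using lift[of t] nz[of t] by (simp add: q_def exp_eq_polar)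
  qed
  then have "winding_number w 0 = (q 1 - q 0) / (2 * of_real pi * \<i>)"
    using winding_number_compose_exp[OF \<open>path q\<close>] by (simp add: pathstart_def pathfinish_def)
  then have "real_winding w = (2 * \<theta> 1 - 2 * \<theta> 0) / (4 * pi)"
    by (simp add: real_winding_def q_def Re_divide power2_eq_square mult.commute)
  then show ?thesis by (simp add: field_simps)
qed

definition Cross :: "nat \<Rightarrow> (nat \<Rightarrow> real \<Rightarrow> complex) \<Rightarrow> real" where
  "Cross n x = (\<Sum>k\<in>{1..n}. \<Sum>k'\<in>{1..n} - {k}. real_winding (\<lambda>t. x k t - x k' t))"

section \<open>Hamiltonians and almost complex structures\<close>

definition Hamiltonians :: "(real \<Rightarrow> complex \<Rightarrow> real) set" where
  "Hamiltonians = {H.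
     smooth_on (UNIV \<times> cball 0 1) (\<lambda>(t, x). H t x) \<and>
     (\<forall>t. \<forall>x\<in>cball 0 1. H (t + 1) x = H t x) \<and>
     (\<forall>t. \<forall>x\<in>sphere 0 1. H t x = 0)}"

definition omega0 :: "complex \<Rightarrow> complex \<Rightarrow> real" where
  "omega0 v w = Re v * Im w - Im v * Re w"

definition metric_of :: "(complex \<Rightarrow>\<^sub>L complex) \<Rightarrow> complex \<Rightarrow> complex \<Rightarrow> real" where
  "metric_of A v w = omega0 v (blinfun_apply A w)"

definition compatible_acs :: "(complex \<Rightarrow>\<^sub>L complex) \<Rightarrow> bool" where
  "compatible_acs A \<longleftrightarrow>
     (\<forall>v. blinfun_apply A (blinfun_apply A v) = - v) \<and>
     (\<forall>v w. omega0 (blinfun_apply A v) (blinfun_apply A w) = omega0 v w) \<and>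
     (\<forall>v w. metric_of A v w = metric_of A w v) \<and>
     (\<forall>v. v \<noteq> 0 \<longrightarrow> metric_of A v v > 0)"

definition acs_families :: "(real \<Rightarrow> complex \<Rightarrow> (complex \<Rightarrow>\<^sub>L complex)) set" where
  "acs_families = {J.
     smooth_on (UNIV \<times> cball 0 1) (\<lambda>(t, x). J t x) \<and>
     (\<forall>t. \<forall>x\<in>cball 0 1. J (t + 1) x = J t x) \<and>
     (\<forall>t. \<forall>x\<in>cball 0 1. compatible_acs (J t x))}"

text \<open>The differential is taken within the disc, so that it also makes sense at boundary points,
  where it is the differential of any smooth extension; uniqueness is
  \<open>has_derivative_unique_cball\<close>.\<close>

definition grad :: "(complex \<Rightarrow>\<^sub>L complex) \<Rightarrow> (complex \<Rightarrow> real) \<Rightarrow> complex \<Rightarrow> complex" where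
  "grad A h x = (THE X. \<forall>v. metric_of A X v = frechet_derivative h (at x within cball 0 1) v)"

lemma has_derivative_unique_cball:
  fixes h :: "complex \<Rightarrow> real"
  assumes x: "x \<in> cball 0 1"
    and D: "(h has_derivative D) (at x within cball 0 1)"
    and E: "(h has_derivative E) (at x within cball 0 1)"
  shows "D = E"
proof -
  interpret D: bounded_linear D using D by (rule has_derivative_bounded_linear)
  interpret E: bounded_linear E using E by (rule has_derivative_bounded_linear)
  have eq: "D (y - x) = E (y - x)" if y: "y \<in> cball 0 1" for y
  proof -
    define c where "c r = x + r *\<^sub>R (y - x)" for r :: real
    have c0: "c 0 = x" by (simp add: c_def)
    have sub: "c ` {0..1} \<subseteq> cball 0 1"
    proof clarify
      fix r :: real assume "r \<in> {0..1}"
      then have "(1 - r) *\<^sub>R x + r *\<^sub>R y \<in> cball 0 1"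
        using x y by (intro convexD[OF convex_cball]) auto
      then show "c r \<in> cball 0 1" by (simp add: c_def algebra_simps)
    qed
    have c: "(c has_derivative (\<lambda>r. r *\<^sub>R (y - x))) (at 0 within {0..1})"
      unfolding c_def by (auto intro!: derivative_eq_intros)
    have vec: "((h \<circ> c) has_vector_derivative F (y - x)) (at 0 within {0..1})"
      if F: "(h has_derivative F) (at x within cball 0 1)" for F
    proof -
      have lin: "linear F" using F by (rule has_derivative_linear)
      have "(h has_derivative F) (at (c 0) within c ` {0..1})"
        unfolding c0 using has_derivative_subset[OF F sub] .
      from diff_chain_within[OF c this]
      show ?thesis
        by (simp add: has_vector_derivative_def o_def linear_cmul[OF lin])
    qed
    show ?thesis
      by (rule vector_derivative_unique_within[OF _ vec[OF D] vec[OF E]])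
        (simp add: trivial_limit_within)
  qed
  have Dx: "D x = E x"
    using eq[of 0] by (simp add: D.neg E.neg)
  have ball: "D y = E y" if "y \<in> cball 0 1" for y
    using eq[OF that] Dx by (simp add: D.diff E.diff)
  have "D v = E v" for v
  proof (cases "v = 0")
    case True
    then show ?thesis by (simp add: D.zero E.zero)
  next
    case False
    then have "D v = norm v *\<^sub>R D (v /\<^sub>R norm v)" by (simp add: D.scaleR)
    also have "\<dots> = norm v *\<^sub>R E (v /\<^sub>R norm v)" using ball[of "v /\<^sub>R norm v"] False by simp
    also have "\<dots> = E v" using False by (simp add: E.scaleR)
    finally show ?thesis .
  qed
  then show ?thesis by blast
qed

lemma grad_characterization:
  assumes A: "compatible_acs A" and x: "x \<in> cball 0 1"
    and h: "(h has_derivative D) (at x within cball 0 1)"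
  shows "metric_of A (grad A h x) v = D v"
proof -
  have DF: "frechet_derivative h (at x within cball 0 1) = D"
    using has_derivative_unique_cball[OF x _ h] h frechet_derivative_works differentiable_def
    by blast
  have lin: "linear D" using h by (rule has_derivative_linear)
  have AA: "blinfun_apply A (blinfun_apply A w) = - w" for w
    using A by (simp add: compatible_acs_def)
  have "\<exists>!X. \<forall>v. metric_of A X v = D v"
  proof (rule ex_ex1I)
    let ?X = "Complex (D (- blinfun_apply A \<i>)) (D (blinfun_apply A 1))"
    have "metric_of A ?X v = D v" for v
    proof -
      define w where "w = blinfun_apply A v"
      have "w = Re w *\<^sub>R 1 + Im w *\<^sub>R \<i>" by (simp add: complex_eq_iff)
      then have "blinfun_apply A w = Re w *\<^sub>R blinfun_apply A 1 + Im w *\<^sub>R blinfun_apply A \<i>"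
        by (metis blinfun.add_right blinfun.scaleR_right)
      moreover have "v = - blinfun_apply A w" by (simp add: w_def AA)
      ultimately have "D v = - (Re w * D (blinfun_apply A 1) + Im w * D (blinfun_apply A \<i>))"
        by (simp add: linear_add[OF lin] linear_neg[OF lin] linear_cmul[OF lin] linear_diff[OF lin])
      then show ?thesis
        by (simp add: metric_of_def omega0_def linear_neg[OF lin] algebra_simps flip: w_def)
    qed
    then show "\<exists>X. \<forall>v. metric_of A X v = D v" by blast
  next
    fix X Y assume "\<forall>v. metric_of A X v = D v" "\<forall>v. metric_of A Y v = D v"
    then have "metric_of A X (X - Y) = metric_of A Y (X - Y)" by simp
    then have "metric_of A (X - Y) (X - Y) = 0"
      by (simp add: metric_of_def omega0_def algebra_simps)
    then show "X = Y"
      using A unfolding compatible_acs_def by (metis eq_iff_diff_eq_0 less_irrefl)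
  qed
  from theI'[OF this] show ?thesis unfolding grad_def DF by blast
qed

section \<open>Solutions of the nonlinear Cauchy-Riemann equations\<close>

text \<open>The strand \<open>u k\<close> takes the arguments \<open>s\<close>, \<open>t\<close> in this order.  The permutation of the
  strands provided by \<^const>\<open>singular_braids\<close> may a priori depend on \<open>s\<close>.\<close>

definition CR_solutions ::
  "nat \<Rightarrow> (real \<Rightarrow> complex \<Rightarrow> (complex \<Rightarrow>\<^sub>L complex)) \<Rightarrow> (real \<Rightarrow> complex \<Rightarrow> real)
    \<Rightarrow> (nat \<Rightarrow> real \<Rightarrow> real \<Rightarrow> complex) set" where
  "CR_solutions n J H = {u.
     (\<forall>k\<in>{1..n}. Ck_on 1 (\<lambda>(s, t). u k s t) UNIV) \<and>
     (\<forall>s. (\<lambda>k. u k s) \<in> singular_braids n) \<and>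
     (\<forall>k\<in>{1..n}. \<forall>s t.
        vector_derivative (\<lambda>s. u k s t) (at s)
        - blinfun_apply (J t (u k s t)) (vector_derivative (\<lambda>t. u k s t) (at t))
        - grad (J t (u k s t)) (H t) (u k s t) = 0)}"

end

theory Submission
  imports Defs
begin

text \<open>For two strands put \<open>W = u\<^sup>k - u\<^sup>l\<close> as a function of \<open>z = t + \<i> s\<close>.  Subtracting the equations and
  using the Lipschitz bounds of \<open>J\<close> and of the gradient gives \<open>|W\<^sub>s - A W\<^sub>t| \<le> M |W|\<close> with
  \<open>A = J(t, u\<^sup>k)\<close>; in the moving frame \<open>1, A 1\<close> this reads \<open>|dbar V| \<le> M |V|\<close>.  By the Carleman
  similarity principle, on any ball \<open>V\<close> has the same zeros and the same winding along loops as a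
  holomorphic function \<open>h\<close>.  Given \<open>s1 < s2\<close> at which the braids are nonsingular, apply the argument
  principle to \<open>h\<close> on a rectangle \<open>[a, a + 1] \<times> [s1, s2]\<close> whose boundary contains no collision, and
  sum over all pairs of strands: the vertical sides cancel by periodicity, the horizontal ones
  contribute \<open>Cross(s1) - Cross(s2)\<close>, and the total is the number of collisions counted with
  positive multiplicities.\<close>

section \<open>A Cauchy--Pompeiu estimate\<close>

text \<open>The strands are only C^1, so \<open>b\<close> = dbar \<open>v\<close> is merely
  continuous and \<open>b / v\<close> may be discontinuous at every zero of \<open>v\<close>. The
  usual proof of the similarity principle solves dbar \<open>P = - b / v\<close> by the Cauchy
  transform and needs regularity theory for such right-hand sides. Here an approximate conjugation
  suffices: only zeros and winding numbers have to pass to the limit, and these are stable as soon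
  as the functions \<open>P\<close> share one bound. Hence the weight put on a dbar estimate that
  depends on nothing but the supremum of the right-hand side. Strands may also touch the boundary of
  the disc, beyond which \<open>J\<close> and \<open>H\<close> have no values: extensions to a
  neighbourhood supply derivatives, and convexity of the disc supplies Lipschitz bounds. Finally,
  the difference of two strands need not close up after one period, so a single pair gives no
  balanced count; only the sum over all ordered pairs does. Comparing two nonsingular levels, rather
  than expanding at a collision, excludes identically vanishing differences from the start, and
  strictness then holds at every distance from \<open>s0\<close>.\<close>

text \<open>\<open>a\<close> and \<open>b\<close> are the Wirtinger derivatives \<open>\<partial>f/\<partial>z\<close> and \<open>\<partial>f/\<partial>(cnj z)\<close>; the latter is called
  dbar f below.\<close>

definition wirtinger :: "complex set \<Rightarrow> (complex \<Rightarrow> complex) \<Rightarrow> (complex \<Rightarrow> complex) \<Rightarrow> (complex \<Rightarrow> complex) \<Rightarrow> bool"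
  where "wirtinger U f a b \<longleftrightarrow> continuous_on U a \<and> continuous_on U b \<and>
    (\<forall>z\<in>U. (f has_derivative (\<lambda>X. a z * X + b z * cnj X)) (at z))"

lemma wirtingerD:
  assumes "wirtinger U f a b" "z \<in> U"
  shows "(f has_derivative (\<lambda>X. a z * X + b z * cnj X)) (at z)"
  using assms by (simp add: wirtinger_def)

lemma wirtinger_continuous:
  assumes "wirtinger U f a b"
  shows "continuous_on U f"
  using assms unfolding wirtinger_def
  by (metis continuous_at_imp_continuous_on has_derivative_continuous)

lemma wirtinger_add:
  assumes "wirtinger U f a b" "wirtinger U g c d"
  shows "wirtinger U (\<lambda>z. f z + g z) (\<lambda>z. a z + c z) (\<lambda>z. b z + d z)"
  using assms unfolding wirtinger_def
  by (auto intro!: continuous_intros derivative_eq_intros simp: algebra_simps)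

lemma wirtinger_mult:
  assumes "wirtinger U f a b" "wirtinger U g c d"
  shows "wirtinger U (\<lambda>z. f z * g z) (\<lambda>z. f z * c z + a z * g z) (\<lambda>z. f z * d z + b z * g z)"
  using assms wirtinger_continuous[OF assms(1)] wirtinger_continuous[OF assms(2)]
  unfolding wirtinger_def
  by (auto intro!: continuous_intros derivative_eq_intros simp: algebra_simps)

lemma wirtinger_exp:
  assumes "wirtinger U f a b"
  shows "wirtinger U (\<lambda>z. exp (f z)) (\<lambda>z. exp (f z) * a z) (\<lambda>z. exp (f z) * b z)"
proof -
  have "((\<lambda>z. exp (f z)) has_derivative (\<lambda>X. exp (f z) * a z * X + exp (f z) * b z * cnj X)) (at z)"
    if "z \<in> U" for z
  proof -
    have "(exp has_derivative (\<lambda>X. X * exp (f z))) (at (f z))"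
      using DERIV_exp[of "f z"] by (simp add: has_field_derivative_def mult_commute_abs)
    from has_derivative_compose[OF wirtingerD[OF assms that] this]
    show ?thesis by (simp add: algebra_simps)
  qed
  then show ?thesis
    using assms wirtinger_continuous[OF assms] unfolding wirtinger_def
    by (auto intro!: continuous_intros)
qed

lemma wirtinger_holomorphic:
  assumes "open U" "f holomorphic_on U"
  shows "wirtinger U f (deriv f) (\<lambda>_. 0)"
  using assms holomorphic_derivI[OF assms(2,1)] holomorphic_on_imp_continuous_on[OF holomorphic_deriv[OF assms(2,1)]]
  unfolding wirtinger_def by (auto simp: has_field_derivative_def)

lemma wirtinger_subset: "wirtinger U f a b \<Longrightarrow> V \<subseteq> U \<Longrightarrow> wirtinger V f a b"
  unfolding wirtinger_def by (meson continuous_on_subset subsetD)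

text \<open>With \<open>g\<close> the boundary circle, shrink it linearly to \<open>w\<close>: \<open>F r\<close> is the Cauchy integral over the circle
  \<open>w + r (g - w)\<close>, so \<open>F 0 = 2 \<pi> \<i> f w\<close>.  Subtracting the integral of the derivative of the
  closed curve \<open>f (w + r (g - w))\<close> cancels the \<open>a\<close>-part of \<open>F' r\<close>, and what is left is bounded by
  \<open>2 |b| |g'|\<close>.  No singular integral occurs.\<close>

lemma cauchy_pompeiu_bound:
  assumes cb: "cball c R \<subseteq> U" and f: "wirtinger U f a b"
    and B: "\<And>z. z \<in> cball c R \<Longrightarrow> norm (b z) \<le> B" and w: "w \<in> ball c R"
  shows "norm (contour_integral (circlepath c R) (\<lambda>z. f z / (z - w)) - 2 * pi * \<i> * f w) \<le> 4 * pi * R * B"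
proof -
  have "R > 0" using w by (metis ball_eq_empty empty_iff not_le)
  define g where "g \<tau> = c + R * exp (2 * pi * \<i> * of_real \<tau>)" for \<tau> :: real
  define g' where "g' \<tau> = 2 * pi * \<i> * R * exp (2 * pi * \<i> * of_real \<tau>)" for \<tau> :: real
  define p where "p r \<tau> = w + of_real r * (g \<tau> - w)" for r \<tau> :: real
  have g: "circlepath c R = g"
    by (simp add: circlepath g_def fun_eq_iff algebra_simps)
  have gv: "(g has_vector_derivative g' \<tau>) (at \<tau>)" for \<tau>
    unfolding g_def g'_def
    by (rule has_vector_derivative_real_field) (auto intro!: derivative_eq_intros)
  have ng': "norm (g' \<tau>) = 2 * pi * R" for \<tau>
    using \<open>R > 0\<close> by (simp add: g'_def norm_mult)
  have gc: "g \<tau> \<in> cball c R" for \<tau>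
    using \<open>R > 0\<close> by (simp add: g_def dist_norm norm_mult)
  have gw: "g \<tau> - w \<noteq> 0" for \<tau>
  proof -
    have "dist c (g \<tau>) = R" using \<open>R > 0\<close> by (simp add: g_def dist_norm norm_mult)
    with w show ?thesis by auto
  qed
  have pc: "p r \<tau> \<in> cball c R" if "r \<in> {0..1}" for r \<tau>
  proof -
    have "(1 - r) *\<^sub>R w + r *\<^sub>R g \<tau> \<in> cball c R"
      using that w gc by (intro convexD[OF convex_cball]) auto
    then show ?thesis by (simp add: p_def scaleR_conv_of_real algebra_simps)
  qed
  have cg: "continuous_on UNIV g" and cg': "continuous_on UNIV g'"
    unfolding g_def g'_def by (auto intro!: continuous_intros)
  have cp: "continuous_on S (\<lambda>x. p (fst x) (snd x))" for S
    unfolding p_def by (intro continuous_intros continuous_on_compose2[OF cg]) auto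
  have ca: "continuous_on U a" and cbb: "continuous_on U b" and cf: "continuous_on U f"
    using f wirtinger_continuous[OF f] by (auto simp: wirtinger_def)
  have pU: "(\<lambda>x. p (fst x) (snd x)) ` ({0..1} \<times> T) \<subseteq> U" for T
    using pc cb by auto
  \<comment> \<open>On the shrunken circle \<open>dz / (z - w)\<close> is
    \<open>r g' / (r (g - w))\<close>. The factor \<open>r\<close> cancels, so the integrand stays
    continuous at \<open>r = 0\<close>.\<close>
  define F where "F r = integral {0..1} (\<lambda>\<tau>. f (p r \<tau>) * (g' \<tau> / (g \<tau> - w)))" for r
  define Fx where "Fx r \<tau> = (a (p r \<tau>) * (g \<tau> - w) + b (p r \<tau>) * cnj (g \<tau> - w)) * (g' \<tau> / (g \<tau> - w))"
    for r \<tau>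
  have [continuous_intros]: "continuous_on S (\<lambda>x. g (h x))" "continuous_on S (\<lambda>x. g' (h x))"
    if "continuous_on S h" for h and S :: "'z::topological_space set"
    using continuous_on_compose2[OF cg that] continuous_on_compose2[OF cg' that] by auto
  have cpr: "continuous_on T (p r)" for r T
    unfolding p_def by (intro continuous_intros)
  have cpo: "continuous_on {0..1} (\<lambda>\<tau>. h (p r \<tau>))" if "continuous_on U h" "r \<in> {0..1}" for h :: "complex \<Rightarrow> complex" and r
    using continuous_on_compose2[OF that(1) cpr] pc[OF that(2)] cb by blast
  have Fder: "(F has_vector_derivative integral {0..1} (Fx r)) (at r within {0..1})" if r: "r \<in> {0..1}" for r
  proof -
    have "((\<lambda>r. integral (cbox 0 1) (\<lambda>\<tau>. f (p r \<tau>) * (g' \<tau> / (g \<tau> - w)))) has_vector_derivative integral (cbox 0 1) (Fx r)) (at r within {0..1})"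
    proof (rule leibniz_rule_vector_derivative)
      fix x \<tau> :: real assume x: "x \<in> {0..1}"
      have "((\<lambda>x. p x \<tau>) has_derivative (\<lambda>h. h * (g \<tau> - w))) (at x within {0..1})"
        unfolding p_def by (auto intro!: derivative_eq_intros)
      moreover have "(f has_derivative (\<lambda>X. a (p x \<tau>) * X + b (p x \<tau>) * cnj X)) (at (p x \<tau>))"
        using wirtingerD[OF f] pc[OF x] cb by blast
      ultimately have "((\<lambda>x. f (p x \<tau>)) has_derivative (\<lambda>h. a (p x \<tau>) * (h * (g \<tau> - w)) + b (p x \<tau>) * cnj (h * (g \<tau> - w)))) (at x within {0..1})"
        by (rule has_derivative_compose)
      then have "((\<lambda>x. f (p x \<tau>)) has_vector_derivative (a (p x \<tau>) * (g \<tau> - w) + b (p x \<tau>) * cnj (g \<tau> - w))) (at x within {0..1})"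
        unfolding has_vector_derivative_def by (simp add: scaleR_conv_of_real algebra_simps)
      then show "((\<lambda>x. f (p x \<tau>) * (g' \<tau> / (g \<tau> - w))) has_vector_derivative Fx x \<tau>) (at x within {0..1})"
        unfolding Fx_def by (rule has_vector_derivative_mult_left)
    next
      fix x :: real assume "x \<in> {0..1}"
      then show "(\<lambda>\<tau>. f (p x \<tau>) * (g' \<tau> / (g \<tau> - w))) integrable_on cbox 0 1"
        using cpo[OF cf] gw by (auto intro!: integrable_continuous_interval continuous_intros)
    next
      have "continuous_on ({0..1} \<times> {0..1}) (\<lambda>x. Fx (fst x) (snd x))"
        unfolding Fx_def using gw
        by (intro continuous_intros continuous_on_compose2[OF ca cp pU] continuous_on_compose2[OF cbb cp pU]) auto
      then show "continuous_on ({0..1} \<times> cbox 0 1) (\<lambda>(x, t). Fx x t)"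
        by (simp add: split_beta)
    qed (use r in auto)
    then show ?thesis unfolding F_def[abs_def] by simp
  qed
  have Fbound: "norm (integral {0..1} (Fx r)) \<le> 4 * pi * R * B" if r: "0 < r" "r < 1" for r
  proof -
    have r': "r \<in> {0..1}" using r by auto
    define D where "D \<tau> = a (p r \<tau>) * g' \<tau> + b (p r \<tau>) * cnj (g' \<tau>)" for \<tau>
    have "((\<lambda>\<tau>. r * D \<tau>) has_integral (f (p r 1) - f (p r 0))) {0..1}"
    proof (rule fundamental_theorem_of_calculus)
      fix \<tau> :: real
      have "((\<lambda>\<tau>. p r \<tau>) has_derivative (\<lambda>h. r * (h *\<^sub>R g' \<tau>))) (at \<tau> within {0..1})"
        unfolding p_def using gv[of \<tau>, unfolded has_vector_derivative_def, THEN has_derivative_at_withinI]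
        by (auto intro!: derivative_eq_intros)
      moreover have "(f has_derivative (\<lambda>X. a (p r \<tau>) * X + b (p r \<tau>) * cnj X)) (at (p r \<tau>))"
        using wirtingerD[OF f] pc[OF r'] cb by blast
      ultimately have "((\<lambda>\<tau>. f (p r \<tau>)) has_derivative (\<lambda>h. a (p r \<tau>) * (r * (h *\<^sub>R g' \<tau>)) + b (p r \<tau>) * cnj (r * (h *\<^sub>R g' \<tau>)))) (at \<tau> within {0..1})"
        by (rule has_derivative_compose)
      then show "((\<lambda>\<tau>. f (p r \<tau>)) has_vector_derivative r * D \<tau>) (at \<tau> within {0..1})"
        unfolding has_vector_derivative_def D_def by (simp add: scaleR_conv_of_real algebra_simps)
    qed simp
    moreover have "p r 1 = p r 0"
      by (simp add: p_def g_def)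
    ultimately have "((\<lambda>\<tau>. r * D \<tau>) has_integral 0) {0..1}"
      by simp
    \<comment> \<open>Dividing by \<open>r\<close> restricts the bound to \<open>r > 0\<close>; the
      mean value estimate for \<open>F\<close> asks for it only in the open interval.\<close>
    from has_integral_mult_right[OF this, of "of_real (1/r)"]
    have D0: "(D has_integral 0) {0..1}"
      using r by simp
    have "Fx r integrable_on {0..1}"
      unfolding Fx_def using cpo[OF ca r'] cpo[OF cbb r'] gw
      by (auto intro!: integrable_continuous_interval continuous_intros)
    then have "((\<lambda>\<tau>. Fx r \<tau> - D \<tau>) has_integral (integral {0..1} (Fx r) - 0)) {0..1}"
      using D0 by (intro has_integral_diff) auto
    then have "((\<lambda>\<tau>. Fx r \<tau> - D \<tau>) has_integral (integral {0..1} (Fx r))) (cbox 0 1)"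
      by simp
    then have "norm (integral {0..1} (Fx r)) \<le> (4 * pi * R * B) * measure lborel (cbox 0 (1::real))"
    proof (rule has_integral_bound[rotated])
      have B0: "B \<ge> 0" using order_trans[OF norm_ge_zero B[of c]] \<open>R > 0\<close> by simp
      then show "0 \<le> 4 * pi * R * B" using \<open>R > 0\<close> by simp
      fix \<tau> :: real
      \<comment> \<open>The quotient \<open>cnj (g - w) / (g - w)\<close> is unimodular, so the
        bracket is at most \<open>2 |g'|\<close> with \<open>|g'| = 2 \<pi> R\<close>; this is the
        constant \<open>4 \<pi> R B\<close>.\<close>
      have "Fx r \<tau> - D \<tau> = b (p r \<tau>) * (cnj (g \<tau> - w) / (g \<tau> - w) * g' \<tau> - cnj (g' \<tau>))"
        unfolding Fx_def D_def using gw[of \<tau>] by (simp add: field_simps)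
      then have "norm (Fx r \<tau> - D \<tau>) = norm (b (p r \<tau>)) * norm (cnj (g \<tau> - w) / (g \<tau> - w) * g' \<tau> - cnj (g' \<tau>))"
        by (simp only: norm_mult)
      also have "\<dots> \<le> B * (norm (cnj (g \<tau> - w) / (g \<tau> - w) * g' \<tau>) + norm (cnj (g' \<tau>)))"
        by (intro mult_mono B pc r' norm_triangle_ineq4 B0) auto
      also have "norm (cnj (g \<tau> - w) / (g \<tau> - w) * g' \<tau>) = norm (g' \<tau>)"
        using gw[of \<tau>] by (simp only: norm_mult norm_divide complex_mod_cnj) simp
      also have "B * (norm (g' \<tau>) + norm (cnj (g' \<tau>))) = 4 * pi * R * B"
        by (simp add: ng')
      finally show "norm (Fx r \<tau> - D \<tau>) \<le> 4 * pi * R * B" .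
    qed
    then show ?thesis by simp
  qed
  have "norm (F 1 - F 0) \<le> 4 * pi * R * B * 1 - 4 * pi * R * B * 0"
  proof (rule differentiable_bound_general)
    show "continuous_on {0..1} F"
      using Fder by (meson continuous_on_eq_continuous_within has_vector_derivative_continuous)
    show "(F has_vector_derivative integral {0..1} (Fx r)) (at r)" if "0 < r" "r < 1" for r
    proof -
      have "(F has_vector_derivative integral {0..1} (Fx r)) (at r within {0<..<1})"
        using Fder[of r] that by (intro has_vector_derivative_within_subset[OF Fder]) auto
      then show ?thesis using that by (subst (asm) has_vector_derivative_within_open) auto
    qed
    show "((\<lambda>r. 4 * pi * R * B * r) has_vector_derivative 4 * pi * R * B) (at r)" for r
      by (auto intro!: derivative_eq_intros simp: has_real_derivative_iff_has_vector_derivative[symmetric])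
  qed (use Fbound in \<open>auto intro!: continuous_intros\<close>)
  moreover have "F 1 = contour_integral (circlepath c R) (\<lambda>z. f z / (z - w))"
    unfolding contour_integral_integral F_def g
    using vector_derivative_at[OF gv] by (simp add: p_def)
  moreover have "F 0 = 2 * pi * \<i> * f w"
  proof -
    have "((\<lambda>z. f w / (z - w)) has_contour_integral 2 * pi * \<i> * f w) (circlepath c R)"
      using Cauchy_integral_circlepath_simple[of "\<lambda>_. f w" c R w] w
      by (simp add: dist_norm norm_minus_commute)
    then have "contour_integral (circlepath c R) (\<lambda>z. f w / (z - w)) = 2 * pi * \<i> * f w"
      by (rule contour_integral_unique)
    then show ?thesis
      unfolding contour_integral_integral F_def g
      using vector_derivative_at[OF gv] by (simp add: p_def)
  qed
  ultimately show ?thesis by simp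
qed

text \<open>Polynomials in \<open>z\<close> and \<open>cnj z\<close>, for which dbar has an explicit right inverse.\<close>

inductive zzpoly :: "(complex \<Rightarrow> complex) \<Rightarrow> bool" where
  monom: "zzpoly (\<lambda>z. a * z ^ j * cnj z ^ k)"
| add: "zzpoly f \<Longrightarrow> zzpoly g \<Longrightarrow> zzpoly (\<lambda>z. f z + g z)"

lemma zzpoly_mult_monom: "zzpoly f \<Longrightarrow> zzpoly (\<lambda>z. f z * (a * z ^ j * cnj z ^ k))"
proof (induction rule: zzpoly.induct)
  case (monom b m n)
  have "zzpoly (\<lambda>z. (b * a) * z ^ (m + j) * cnj z ^ (n + k))" by (rule zzpoly.monom)
  then show ?case by (simp add: power_add mult_ac)
next
  case (add f g)
  then show ?case by (simp add: distrib_right zzpoly.add)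
qed

lemma zzpoly_mult: "zzpoly g \<Longrightarrow> zzpoly f \<Longrightarrow> zzpoly (\<lambda>z. f z * g z)"
proof (induction rule: zzpoly.induct)
  case (monom a j k)
  then show ?case by (rule zzpoly_mult_monom)
next
  case (add g h)
  then show ?case by (simp add: distrib_left zzpoly.add)
qed

lemma zzpoly_const: "zzpoly (\<lambda>_. c)"
  using zzpoly.monom[of c 0 0] by simp

lemma zzpoly_Re: "zzpoly (\<lambda>z. of_real (Re z))" and zzpoly_Im: "zzpoly (\<lambda>z. of_real (Im z))"
proof -
  have "(\<lambda>z. of_real (Re z)) = (\<lambda>z. (1/2) * z ^ 1 * cnj z ^ 0 + (1/2) * z ^ 0 * cnj z ^ 1)"
    by (auto simp: fun_eq_iff complex_eq_iff)
  then show "zzpoly (\<lambda>z. of_real (Re z))"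
    by (simp only: zzpoly.add zzpoly.monom)
  have "(\<lambda>z. of_real (Im z)) = (\<lambda>z. (- \<i>/2) * z ^ 1 * cnj z ^ 0 + (\<i>/2) * z ^ 0 * cnj z ^ 1)"
    by (auto simp: fun_eq_iff complex_eq_iff)
  then show "zzpoly (\<lambda>z. of_real (Im z))"
    by (simp only: zzpoly.add zzpoly.monom)
qed

lemma zzpoly_real_polynomial:
  assumes "real_polynomial_function f"
  shows "zzpoly (\<lambda>z. of_real (f z))"
  using assms
proof (induction rule: real_polynomial_function.induct)
  case (linear f)
  interpret bounded_linear f by fact
  have eq: "f z = f 1 * Re z + f \<i> * Im z" for z
  proof -
    have "z = Re z *\<^sub>R 1 + Im z *\<^sub>R \<i>" by (simp add: complex_eq_iff)
    then have "f z = f (Re z *\<^sub>R 1 + Im z *\<^sub>R \<i>)" by simp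
    then show ?thesis by (simp add: add scaleR mult.commute)
  qed
  have "(\<lambda>z. complex_of_real (f z)) = (\<lambda>z. of_real (f 1) * of_real (Re z) + of_real (f \<i>) * of_real (Im z))"
    by (rule ext, subst eq, simp)
  then show ?case
    by (simp only: zzpoly.add zzpoly_mult zzpoly_const zzpoly_Re zzpoly_Im)
qed (auto intro: zzpoly_const zzpoly.add zzpoly_mult)

lemma zzpoly_polynomial_function:
  fixes f :: "complex \<Rightarrow> complex"
  assumes "polynomial_function f"
  shows "zzpoly f"
proof -
  have "real_polynomial_function (Re \<circ> f)" "real_polynomial_function (Im \<circ> f)"
    using assms unfolding polynomial_function_def by (auto intro: bounded_linear_Re bounded_linear_Im)
  then have "zzpoly (\<lambda>z. of_real ((Re \<circ> f) z) + \<i> * of_real ((Im \<circ> f) z))"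
    by (intro zzpoly.add zzpoly_mult zzpoly_const zzpoly_real_polynomial)
  moreover have "(\<lambda>z. of_real ((Re \<circ> f) z) + \<i> * of_real ((Im \<circ> f) z)) = f"
    by (auto simp: fun_eq_iff complex_eq_iff)
  ultimately show ?thesis by simp
qed

text \<open>Integrate in \<open>cnj z\<close> alone: for dbar the holomorphic factor
  \<open>c * z ^ j\<close> behaves like a constant.\<close>

lemma zzpoly_antiderivative:
  assumes "zzpoly q"
  shows "\<exists>Q a. wirtinger UNIV Q a q"
  using assms
proof (induction rule: zzpoly.induct)
  case (monom c j k)
  have "wirtinger UNIV (\<lambda>z. c * z ^ j) (\<lambda>z. deriv (\<lambda>z. c * z ^ j) z) (\<lambda>_. 0)"
    by (intro wirtinger_holomorphic holomorphic_intros) auto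
  moreover have "wirtinger UNIV (\<lambda>z. cnj z ^ Suc k / of_nat (Suc k)) (\<lambda>_. 0) (\<lambda>z. cnj z ^ k)"
    unfolding wirtinger_def
  proof (intro conjI ballI)
    fix z :: complex
    have "((\<lambda>z. z ^ Suc k / of_nat (Suc k)) has_derivative (\<lambda>X. cnj z ^ k * X)) (at (cnj z))"
    proof -
      have "((\<lambda>z. z ^ Suc k / of_nat (Suc k)) has_field_derivative cnj z ^ k) (at (cnj z))"
        by (auto intro!: derivative_eq_intros simp del: of_nat_Suc power_Suc)
      then show ?thesis by (simp add: has_field_derivative_def)
    qed
    moreover have "(cnj has_derivative cnj) (at z)"
      by (intro bounded_linear_imp_has_derivative bounded_linear_cnj)
    ultimately show "((\<lambda>z. cnj z ^ Suc k / of_nat (Suc k)) has_derivative (\<lambda>X. 0 * X + cnj z ^ k * cnj X)) (at z)"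
      using has_derivative_compose[of cnj cnj z UNIV] by (simp del: power_Suc of_nat_Suc)
  qed (auto intro!: continuous_intros)
  ultimately have "wirtinger UNIV (\<lambda>z. c * z ^ j * (cnj z ^ Suc k / of_nat (Suc k)))
      (\<lambda>z. c * z ^ j * 0 + deriv (\<lambda>z. c * z ^ j) z * (cnj z ^ Suc k / of_nat (Suc k)))
      (\<lambda>z. c * z ^ j * cnj z ^ k + 0 * (cnj z ^ Suc k / of_nat (Suc k)))"
    by (rule wirtinger_mult)
  then show ?case by auto
next
  case (add f g)
  then show ?case using wirtinger_add by blast
qed

section \<open>Approximate solution of the dbar equation on a disc\<close>

text \<open>Differentiate the kernel in \<open>w\<close>. Since \<open>f\<close> is only continuous
  on the circle, the integral does not reproduce \<open>f\<close> in general.\<close>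

lemma Cauchy_integral_holomorphic:
  assumes "continuous_on (sphere c R) f"
  shows "(\<lambda>w. contour_integral (circlepath c R) (\<lambda>z. f z / (z - w))) holomorphic_on ball c R"
proof (cases "R > 0")
  case True
  then have pi: "path_image (circlepath c R) = sphere c R" by simp
  have "\<exists>d. ((\<lambda>w. contour_integral (circlepath c R) (\<lambda>z. f z / (z - w))) has_field_derivative d) (at w)"
    if w: "w \<in> ball c R" for w
  proof -
    have "((\<lambda>u. f u / (u-v)^1) has_contour_integral contour_integral (circlepath c R) (\<lambda>z. f z / (z - v))) (circlepath c R)"
      if v: "v \<in> ball c R" for v
    proof -
      have "(\<lambda>u. f u / (u-v)) contour_integrable_on (circlepath c R)"
        using v True assms
        by (intro contour_integrable_continuous_circlepath) (auto intro!: continuous_intros)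
      then show ?thesis by (simp add: has_contour_integral_integral)
    qed
    from Cauchy_next_derivative_circlepath(2)[OF _ this _ w] show ?thesis
      using assms pi by auto
  qed
  then show ?thesis by (simp add: holomorphic_on_open)
qed (simp add: ball_empty holomorphic_on_def)

text \<open>The explicit antiderivative \<open>Q\<close> of a polynomial approximation
  \<open>q\<close> comes with no control of its size. Subtracting its Cauchy integral leaves dbar
  unchanged, and the difference is exactly what the Cauchy-Pompeiu estimate bounds:
  \<open>4 \<pi> R (B + e)\<close> divided by \<open>2 \<pi>\<close>. The bound sees only the
  supremum of \<open>q\<close>, not its degree or derivatives, so it survives better and better
  approximation.\<close>

lemma dbar_approx_solution:
  assumes R: "R > 0" and c: "continuous_on (cball 0 R) c" and B: "\<And>z. z \<in> cball 0 R \<Longrightarrow> norm (c z) \<le> B"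
    and e: "e > 0"
  shows "\<exists>P a q. wirtinger (ball 0 R) P a q \<and> (\<forall>z\<in>ball 0 R. norm (c z - q z) \<le> e \<and> norm (P z) \<le> 2 * R * (B + e))"
proof -
  obtain q where q: "polynomial_function q" "\<And>z. z \<in> cball 0 R \<Longrightarrow> norm (c z - q z) < e"
    using Stone_Weierstrass_polynomial_function[OF compact_cball c e] by blast
  obtain Q a where Q: "wirtinger UNIV Q a q"
    using zzpoly_antiderivative[OF zzpoly_polynomial_function[OF q(1)]] by blast
  define C where "C w = - 1 / (2 * pi * \<i>) * contour_integral (circlepath 0 R) (\<lambda>z. Q z / (z - w))" for w
  have "C holomorphic_on ball 0 R"
    unfolding C_def
    by (intro holomorphic_intros Cauchy_integral_holomorphic continuous_on_subset[OF wirtinger_continuous[OF Q]]) auto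
  then have "wirtinger (ball 0 R) C (deriv C) (\<lambda>_. 0)"
    by (intro wirtinger_holomorphic) auto
  from wirtinger_add[OF wirtinger_subset[OF Q] this]
  have P: "wirtinger (ball 0 R) (\<lambda>z. Q z + C z) (\<lambda>z. a z + deriv C z) q" by simp
  have qB: "norm (q z) \<le> B + e" if "z \<in> cball 0 R" for z
    using q(2)[OF that] B[OF that] norm_triangle_ineq2[of "q z" "c z"] by (simp add: norm_minus_commute)
  have "norm (Q w + C w) \<le> 2 * R * (B + e)" if w: "w \<in> ball 0 R" for w
  proof -
    define I where "I = contour_integral (circlepath 0 R) (\<lambda>z. Q z / (z - w))"
    have "norm (I - 2 * pi * \<i> * Q w) \<le> 4 * pi * R * (B + e)"
      unfolding I_def by (rule cauchy_pompeiu_bound[OF _ Q qB w]) auto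
    moreover have "Q w + C w = - 1 / (2 * pi * \<i>) * (I - 2 * pi * \<i> * Q w)"
      by (simp add: C_def I_def field_simps)
    then have "norm (Q w + C w) = 1 / (2 * pi) * norm (I - 2 * pi * \<i> * Q w)"
      by (simp only: norm_mult norm_divide norm_minus_cancel) simp
    ultimately have "norm (Q w + C w) \<le> 1 / (2 * pi) * (4 * pi * R * (B + e))"
      by (simp only:) (rule mult_left_mono, auto)
    then show ?thesis by simp
  qed
  moreover have "norm (c w - q w) \<le> e" if "w \<in> ball 0 R" for w
    using q(2)[of w] that by force
  ultimately show ?thesis using P by (intro exI conjI ballI) auto
qed

section \<open>The similarity principle\<close>

text \<open>One would like to solve dbar \<open>P = - b / v\<close>, but this quotient is only bounded.  The continuous
  functions \<open>c = - b cnj v / (|v|\<^sup>2 + \<epsilon>\<^sup>2)\<close> stay bounded by \<open>M\<close> and satisfy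
  \<open>|b + c v| \<le> M \<epsilon>\<close>, because \<open>|b| \<le> M |v|\<close>.  So dbar of \<open>exp P * v\<close> tends to \<open>0\<close> uniformly, and
  Montel's theorem yields a holomorphic limit; the functions \<open>P\<close> themselves need not converge.\<close>

lemma similarity_principle:
  assumes v: "wirtinger U v a b" and R: "cball 0 R \<subseteq> U" "0 < r" "r < R" and M: "M \<ge> 0"
    and bv: "\<forall>z\<in>cball 0 R. norm (b z) \<le> M * norm (v z)"
  shows "\<exists>h K. h holomorphic_on ball 0 r \<and>
    (\<forall>S e. compact S \<longrightarrow> S \<subseteq> ball 0 r \<longrightarrow> 0 < e \<longrightarrow>
      (\<exists>P. continuous_on S P \<and> (\<forall>z\<in>S. norm (P z) \<le> K \<and> norm (exp (P z) * v z - h z) < e)))"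
proof -
  have cv: "continuous_on (cball 0 R) v" and cb: "continuous_on (cball 0 R) b"
    using wirtinger_continuous[OF v] v R(1) unfolding wirtinger_def by (auto intro: continuous_on_subset)
  have "bounded (v ` cball 0 R)"
    by (intro compact_imp_bounded compact_continuous_image cv compact_cball)
  then obtain V where V: "V > 0" "\<And>z. z \<in> cball 0 R \<Longrightarrow> norm (v z) \<le> V"
    unfolding bounded_pos by auto
  define \<epsilon> where "\<epsilon> n = inverse (real (Suc n))" for n
  have \<epsilon>: "\<epsilon> n > 0" "\<epsilon> n \<le> 1" for n by (auto simp: \<epsilon>_def field_simps)
  define c where "c n z = - b z * cnj (v z) / of_real ((norm (v z))\<^sup>2 + (\<epsilon> n)\<^sup>2)" for n z
  have den: "(norm (v z))\<^sup>2 + (\<epsilon> n)\<^sup>2 > 0" for n z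
    using \<epsilon>[of n] by (simp add: add_nonneg_pos)
  have den0: "complex_of_real ((norm (v z))\<^sup>2 + (\<epsilon> n)\<^sup>2) \<noteq> 0" for n z
    using den[of z n] by (metis less_irrefl of_real_eq_0_iff)
  have cc: "continuous_on (cball 0 R) (c n)" for n
    unfolding c_def using den0 by (intro continuous_intros cv cb) auto
  have cM: "norm (c n z) \<le> M" if z: "z \<in> cball 0 R" for n z
  proof -
    have "norm (c n z) = norm (b z) * norm (v z) / ((norm (v z))\<^sup>2 + (\<epsilon> n)\<^sup>2)"
      unfolding c_def norm_divide norm_mult norm_of_real norm_minus_cancel complex_mod_cnj
      using den[of z n] by simp
    also have "\<dots> \<le> (M * norm (v z)) * norm (v z) / ((norm (v z))\<^sup>2 + (\<epsilon> n)\<^sup>2)"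
      by (intro divide_right_mono mult_right_mono bspec[OF bv z]) (auto simp: less_imp_le[OF den])
    also have "\<dots> \<le> M"
      using den[of z n] M by (simp add: divide_le_eq power2_eq_square algebra_simps)
    finally show ?thesis .
  qed
  \<comment> \<open>The bound \<open>2 R (B + e)\<close> with \<open>B = M\<close> and
    \<open>e = \<epsilon> n \<le> 1\<close>, independent of \<open>n\<close>.\<close>
  define K where "K = 2 * R * (M + 1)"
  have "\<exists>P a' q. wirtinger (ball 0 R) P a' q \<and>
      (\<forall>z\<in>ball 0 R. norm (c n z - q z) \<le> \<epsilon> n \<and> norm (P z) \<le> K)" for n
  proof -
    obtain P a' q where P: "wirtinger (ball 0 R) P a' q"
      "\<And>z. z \<in> ball 0 R \<Longrightarrow> norm (c n z - q z) \<le> \<epsilon> n \<and> norm (P z) \<le> 2 * R * (M + \<epsilon> n)"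
      using dbar_approx_solution[OF _ cc cM, of "\<epsilon> n"] R \<epsilon>[of n] by fastforce
    have "2 * R * (M + \<epsilon> n) \<le> K"
      unfolding K_def using \<epsilon>[of n] R by (intro mult_left_mono) auto
    with P show ?thesis by (meson order_trans)
  qed
  then obtain P a' q where P: "\<And>n. wirtinger (ball 0 R) (P n) (a' n) (q n)"
      and qc: "\<And>n z. z \<in> ball 0 R \<Longrightarrow> norm (c n z - q n z) \<le> \<epsilon> n"
      and PK: "\<And>n z. z \<in> ball 0 R \<Longrightarrow> norm (P n z) \<le> K"
    by metis
  define H where "H n z = exp (P n z) * v z" for n z
  \<comment> \<open>By the product rule \<open>\<beta> n\<close> is dbar of \<open>H n\<close>,
    namely \<open>exp P (b + q v)\<close>. It is split as
    \<open>exp P ((b + c v) - (c - q) v)\<close>: the first term is small by the choice of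
    \<open>c\<close>, the second because \<open>q\<close> approximates \<open>c\<close>.\<close>
  define \<beta> where "\<beta> n z = exp (P n z) * b z + exp (P n z) * q n z * v z" for n z
  define \<alpha> where "\<alpha> n z = exp (P n z) * a z + exp (P n z) * a' n z * v z" for n z
  have vR: "wirtinger (ball 0 R) v a b"
    using wirtinger_subset[OF v] R(1) ball_subset_cball by blast
  have H: "wirtinger (ball 0 R) (H n) (\<alpha> n) (\<beta> n)" for n
    unfolding H_def[abs_def] \<alpha>_def[abs_def] \<beta>_def[abs_def]
    by (rule wirtinger_mult[OF wirtinger_exp[OF P] vR])
  have expK: "norm (exp (P n z)) \<le> exp K" if "z \<in> ball 0 R" for n z
    using norm_exp[of "P n z"] PK[OF that, of n] by (meson exp_le_cancel_iff order_trans)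
  define \<delta> where "\<delta> n = exp K * (M + V) * \<epsilon> n" for n
  have \<beta>: "norm (\<beta> n z) \<le> \<delta> n" if z: "z \<in> ball 0 R" for n z
  proof -
    have z': "z \<in> cball 0 R" using z by auto
    define m where "m = norm (v z)"
    have m: "m \<ge> 0" "m^2 + (\<epsilon> n)^2 > 0" using den by (auto simp: m_def)
    have vv: "v z * cnj (v z) = of_real (m^2)"
      unfolding m_def by (rule complex_norm_square[symmetric])
    have "(b z + c n z * v z) * of_real (m^2 + (\<epsilon> n)^2) = b z * of_real (m^2 + (\<epsilon> n)^2) - b z * (v z * cnj (v z))"
      using den0[of z n] unfolding c_def m_def by (simp add: field_simps)
    also have "\<dots> = b z * of_real ((\<epsilon> n)^2)"
      unfolding vv by (simp add: algebra_simps)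
    finally have eq: "norm (b z + c n z * v z) * (m^2 + (\<epsilon> n)^2) = norm (b z) * (\<epsilon> n)^2"
      using m by (metis norm_mult norm_of_real abs_of_pos abs_power2)
    \<comment> \<open>The left side of \<open>eq\<close> is to be bounded through
      \<open>|b| \<epsilon>^2 \<le> M m \<epsilon>^2\<close>; this inequality replaces
      \<open>m \<epsilon>\<close> by the denominator, so that
      \<open>|b + c v| \<le> M \<epsilon>\<close> uniformly in \<open>m\<close>, including at zeros
      of \<open>v\<close>.\<close>
    have "\<epsilon> n * m \<le> m^2 + (\<epsilon> n)^2"
    proof -
      have "2 * (\<epsilon> n * m) \<le> m^2 + (\<epsilon> n)^2"
        using sum_squares_bound[of m "\<epsilon> n"] by (simp add: mult_ac)
      moreover have "0 \<le> \<epsilon> n * m" using m(1) \<epsilon>(1)[of n] by simp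
      ultimately show ?thesis by linarith
    qed
    then have "(M * \<epsilon> n) * (\<epsilon> n * m) \<le> (M * \<epsilon> n) * (m^2 + (\<epsilon> n)^2)"
      using M \<epsilon>[of n] by (intro mult_left_mono) auto
    moreover have "norm (b z) * (\<epsilon> n)^2 \<le> (M * m) * (\<epsilon> n)^2"
      using bspec[OF bv z'] by (intro mult_right_mono) (auto simp: m_def)
    ultimately have "norm (b z + c n z * v z) * (m^2 + (\<epsilon> n)^2) \<le> (M * \<epsilon> n) * (m^2 + (\<epsilon> n)^2)"
      unfolding eq by (simp add: power2_eq_square mult_ac)
    then have 1: "norm (b z + c n z * v z) \<le> M * \<epsilon> n"
      using m by (simp only: mult_le_cancel_right)
    have "norm ((c n z - q n z) * v z) \<le> \<epsilon> n * V"
      unfolding norm_mult using qc[OF z] V(2)[OF z'] \<epsilon>[of n] by (intro mult_mono) auto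
    then have 2: "norm (b z + c n z * v z - (c n z - q n z) * v z) \<le> (M + V) * \<epsilon> n"
      using 1 norm_triangle_ineq4[of "b z + c n z * v z" "(c n z - q n z) * v z"] by (simp add: algebra_simps)
    have "\<beta> n z = exp (P n z) * (b z + c n z * v z - (c n z - q n z) * v z)"
      unfolding \<beta>_def by (simp add: algebra_simps)
    then have "norm (\<beta> n z) \<le> exp K * ((M + V) * \<epsilon> n)"
      unfolding norm_mult using expK[OF z] 2 by (auto intro!: mult_mono simp: norm_mult)
    then show ?thesis by (simp add: \<delta>_def mult.assoc)
  qed
  \<comment> \<open>\<open>H n\<close> is only nearly holomorphic, and Montel's theorem needs
    holomorphic functions. Its Cauchy integral over a strictly smaller circle is one, and by the
    Cauchy-Pompeiu bound it lies within \<open>2 r \<delta> n\<close> of \<open>H n\<close>.\<close>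
  define G where "G n w = 1 / (2 * pi * \<i>) * contour_integral (circlepath 0 r) (\<lambda>z. H n z / (z - w))" for n w
  have Gh: "G n holomorphic_on ball 0 r" for n
    unfolding G_def[abs_def] using R
    by (intro holomorphic_intros Cauchy_integral_holomorphic continuous_on_subset[OF wirtinger_continuous[OF H]]) auto
  have GH: "norm (G n w - H n w) \<le> 2 * r * \<delta> n" if w: "w \<in> ball 0 r" for n w
  proof -
    define I where "I = contour_integral (circlepath 0 r) (\<lambda>z. H n z / (z - w))"
    have "norm (I - 2 * pi * \<i> * H n w) \<le> 4 * pi * r * \<delta> n"
      unfolding I_def by (rule cauchy_pompeiu_bound[OF _ H \<beta> w]) (use R in auto)
    moreover have "G n w - H n w = 1 / (2 * pi * \<i>) * (I - 2 * pi * \<i> * H n w)"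
      by (simp add: G_def I_def field_simps)
    then have "norm (G n w - H n w) = 1 / (2 * pi) * norm (I - 2 * pi * \<i> * H n w)"
      by (simp only: norm_mult norm_divide) simp
    ultimately have "norm (G n w - H n w) \<le> 1 / (2 * pi) * (4 * pi * r * \<delta> n)"
      by (simp only:) (rule mult_left_mono, auto)
    then show ?thesis by simp
  qed
  have \<delta>1: "\<delta> n \<le> exp K * (M + V)" for n
    unfolding \<delta>_def using \<epsilon>[of n] M V(1) by (intro mult_left_le) auto
  define \<B> where "\<B> = exp K * V + 2 * r * (exp K * (M + V))"
  have GB: "norm (G n w) \<le> \<B>" if w: "w \<in> ball 0 r" for n w
  proof -
    have wR: "w \<in> ball 0 R" "w \<in> cball 0 R" using w R by auto
    have "norm (H n w) \<le> exp K * V"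
      unfolding H_def norm_mult using expK[OF wR(1)] V(2)[OF wR(2)] by (intro mult_mono) auto
    moreover have "2 * r * \<delta> n \<le> 2 * r * (exp K * (M + V))"
      using \<delta>1 R by (intro mult_left_mono) auto
    moreover have "norm (G n w) \<le> norm (H n w) + norm (G n w - H n w)"
      by (metis add.commute diff_add_cancel norm_triangle_ineq)
    ultimately show ?thesis using GH[OF w, of n] by (simp add: \<B>_def)
  qed
  obtain h \<rho> where h: "h holomorphic_on ball 0 r" and \<rho>: "strict_mono (\<rho> :: nat \<Rightarrow> nat)"
    and lim: "\<And>K. compact K \<Longrightarrow> K \<subseteq> ball 0 r \<Longrightarrow> uniform_limit K (G \<circ> \<rho>) h sequentially"
  proof (rule Montel[of "ball 0 r" "{h. h holomorphic_on ball 0 r \<and> (\<forall>z\<in>ball 0 r. norm (h z) \<le> \<B>)}" G])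
    fix K :: "complex set" assume "K \<subseteq> ball 0 r"
    then show "\<exists>B. \<forall>h\<in>{h. h holomorphic_on ball 0 r \<and> (\<forall>z\<in>ball 0 r. cmod (h z) \<le> \<B>)}. \<forall>z\<in>K. cmod (h z) \<le> B"
      by blast
  qed (use Gh GB in \<open>auto simp: image_subset_iff\<close>)
  have "\<epsilon> \<longlonglongrightarrow> 0" unfolding \<epsilon>_def by (rule LIMSEQ_inverse_real_of_nat)
  then have "(\<lambda>n. \<epsilon> (\<rho> n)) \<longlonglongrightarrow> 0"
    using LIMSEQ_subseq_LIMSEQ[OF _ \<rho>] by (fastforce simp: o_def)
  then have lim\<delta>: "(\<lambda>n. 2 * r * \<delta> (\<rho> n)) \<longlonglongrightarrow> 0"
    unfolding \<delta>_def by (auto intro!: tendsto_mult_right_zero)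
  show ?thesis
  proof (rule exI[of _ h], rule exI[of _ K], intro conjI h allI impI)
    fix S :: "complex set" and e :: real assume S: "compact S" "S \<subseteq> ball 0 r" and e: "0 < e"
    have "\<forall>\<^sub>F n in sequentially. \<forall>z\<in>S. dist ((G \<circ> \<rho>) n z) (h z) < e / 2"
      by (rule uniform_limitD[OF lim[OF S]]) (use e in simp)
    moreover have "\<forall>\<^sub>F n in sequentially. 2 * r * \<delta> (\<rho> n) < e / 2"
      by (rule order_tendstoD(2)[OF lim\<delta>]) (use e in simp)
    ultimately have "\<forall>\<^sub>F n in sequentially. (\<forall>z\<in>S. dist ((G \<circ> \<rho>) n z) (h z) < e / 2) \<and> 2 * r * \<delta> (\<rho> n) < e / 2"
      by (rule eventually_conj)
    then obtain n where n: "\<And>z. z \<in> S \<Longrightarrow> norm (G (\<rho> n) z - h z) < e / 2" "2 * r * \<delta> (\<rho> n) < e / 2"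
      by (auto simp: eventually_sequentially dist_norm)
    show "\<exists>P. continuous_on S P \<and> (\<forall>z\<in>S. norm (P z) \<le> K \<and> norm (exp (P z) * v z - h z) < e)"
    proof (intro exI[of _ "P (\<rho> n)"] conjI ballI)
      show "continuous_on S (P (\<rho> n))"
        using S R by (intro continuous_on_subset[OF wirtinger_continuous[OF P]]) auto
      fix z assume z: "z \<in> S"
      show "norm (P (\<rho> n) z) \<le> K" using z S R by (intro PK) auto
      have "norm (G (\<rho> n) z - H (\<rho> n) z) < e / 2"
        using GH[of z "\<rho> n"] n(2) z S by force
      then have "norm (H (\<rho> n) z - h z) < e"
        using n(1)[OF z] norm_diff_triangle_less[of "H (\<rho> n) z" "G (\<rho> n) z" "e/2" "h z" "e/2"]
        by (simp add: norm_minus_commute)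
      then show "norm (exp (P (\<rho> n) z) * v z - h z) < e" by (simp add: H_def)
    qed
  qed
qed

section \<open>Zeros and winding numbers under similarity\<close>

text \<open>Scale the exponent from \<open>0\<close> to \<open>1\<close>. Every intermediate curve
  is closed because \<open>q\<close> is, and none meets \<open>0\<close> because the exponential
  does not.\<close>

lemma winding_number_mult_exp:
  assumes p: "path p" "pathfinish p = pathstart p" "0 \<notin> path_image p"
    and q: "path q" "pathfinish q = pathstart q"
  shows "winding_number (\<lambda>t. exp (q t) * p t) 0 = winding_number p 0"
proof (rule winding_number_homotopic_loops[symmetric], subst homotopic_loops, intro exI conjI)
  let ?h = "\<lambda>x. exp (of_real (fst x) * q (snd x)) * p (snd x)"
  have [continuous_intros]: "continuous_on S (\<lambda>x. p (f x))" "continuous_on S (\<lambda>x. q (f x))"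
    if "continuous_on S f" "f ` S \<subseteq> {0..1}" for S :: "(real \<times> real) set" and f
    using that p q by (auto simp: path_def intro: continuous_on_compose2)
  show "continuous_on ({0..1} \<times> {0..1}) ?h"
    by (intro continuous_intros) auto
  show "?h \<in> {0..1} \<times> {0..1} \<rightarrow> - {0}"
    using p by (auto simp: path_image_def)
qed (use p q in \<open>auto simp: pathfinish_def pathstart_def\<close>)

text \<open>No single \<open>P\<close> with \<open>h = exp P * v\<close> is at hand, so both claims
  rest on approximation. The common bound \<open>K\<close> gives
  \<open>|exp P * v| \<ge> exp (- K) |v|\<close>, which keeps \<open>h\<close> away from
  \<open>0\<close> wherever \<open>v\<close> is nonzero. Along a loop one sufficiently close
  approximation has the winding number of \<open>h\<close>, and the factor \<open>exp P\<close>
  contributes none.\<close>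

lemma similarity_holomorphic:
  assumes v: "wirtinger U v a b" and R: "cball 0 R \<subseteq> U" "0 < r" "r < R"
    and bv: "\<And>z. z \<in> cball 0 R \<Longrightarrow> norm (b z) \<le> M * norm (v z)"
  obtains h where "h holomorphic_on ball 0 r" "\<And>z. z \<in> ball 0 r \<Longrightarrow> h z = 0 \<longleftrightarrow> v z = 0"
    "\<And>\<gamma>. path \<gamma> \<Longrightarrow> pathfinish \<gamma> = pathstart \<gamma> \<Longrightarrow> path_image \<gamma> \<subseteq> ball 0 r \<Longrightarrow>
      0 \<notin> v ` path_image \<gamma> \<Longrightarrow> winding_number (v \<circ> \<gamma>) 0 = winding_number (h \<circ> \<gamma>) 0"
proof -
  have "norm (b z) \<le> max M 0 * norm (v z)" if "z \<in> cball 0 R" for z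
    using bv[OF that] mult_right_mono[of M "max M 0" "norm (v z)"] by simp
  then have bv': "\<forall>z\<in>cball 0 R. norm (b z) \<le> max M 0 * norm (v z)" ..
  obtain h K where hK: "h holomorphic_on ball 0 r \<and>
    (\<forall>S e. compact S \<longrightarrow> S \<subseteq> ball 0 r \<longrightarrow> 0 < e \<longrightarrow>
      (\<exists>P. continuous_on S P \<and> (\<forall>z\<in>S. norm (P z) \<le> K \<and> norm (exp (P z) * v z - h z) < e)))"
    using similarity_principle[OF v R max.cobounded2 bv'] by (elim exE)
  then have h: "h holomorphic_on ball 0 r" by (rule conjunct1)
  have app: "\<exists>P. continuous_on S P \<and> (\<forall>z\<in>S. norm (P z) \<le> K \<and> norm (exp (P z) * v z - h z) < e)"
    if "compact S" "S \<subseteq> ball 0 r" "0 < e" for S e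
    using hK that by simp
  have zeros: "h z = 0 \<longleftrightarrow> v z = 0" if z: "z \<in> ball 0 r" for z
  proof
    assume hz: "h z = 0"
    show "v z = 0"
    proof (rule ccontr)
      assume "v z \<noteq> 0"
      then have "exp (-K) * norm (v z) > 0" by simp
      from app[OF _ _ this, of "{z}"] z obtain P where P: "norm (P z) \<le> K" "norm (exp (P z) * v z - h z) < exp (-K) * norm (v z)"
        by auto
      have "exp (-K) \<le> norm (exp (P z))"
        using P(1) abs_Re_le_cmod[of "P z"] by simp
      then have "exp (-K) * norm (v z) \<le> norm (exp (P z) * v z)"
        unfolding norm_mult by (rule mult_right_mono) simp
      with P(2) hz show False by simp
    qed
  next
    assume vz: "v z = 0"
    show "h z = 0"
    proof (rule ccontr)
      assume "h z \<noteq> 0"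
      then have "norm (h z) > 0" by simp
      from app[OF _ _ this, of "{z}"] z vz show False by auto
    qed
  qed
  have "winding_number (v \<circ> \<gamma>) 0 = winding_number (h \<circ> \<gamma>) 0"
    if g: "path \<gamma>" "pathfinish \<gamma> = pathstart \<gamma>" "path_image \<gamma> \<subseteq> ball 0 r" "0 \<notin> v ` path_image \<gamma>" for \<gamma>
  proof -
    let ?S = "path_image \<gamma>"
    have S: "compact ?S" "?S \<noteq> {}" using g(1) by (auto simp: compact_path_image)
    have ch: "continuous_on ?S h"
      using h g(3) holomorphic_on_imp_continuous_on continuous_on_subset by blast
    have cv: "continuous_on ?S v"
      using wirtinger_continuous[OF v] g(3) R by (force intro: continuous_on_subset)
    \<comment> \<open>The minimum of \<open>|h|\<close> on the loop is the admissible error: an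
      approximation closer to \<open>h\<close> than this winds as \<open>h\<close> does, as in
      Rouche's theorem.\<close>
    obtain z0 where z0: "z0 \<in> ?S" "\<And>z. z \<in> ?S \<Longrightarrow> norm (h z0) \<le> norm (h z)"
      using continuous_attains_inf[OF S, of "\<lambda>z. norm (h z)"] ch by (auto intro: continuous_intros)
    have "norm (h z0) > 0" using zeros z0(1) g(3,4) by force
    from app[OF S(1) g(3) this] obtain P where P: "continuous_on ?S P"
      "\<And>z. z \<in> ?S \<Longrightarrow> norm (exp (P z) * v z - h z) < norm (h z0)" by blast
    have pv: "path (v \<circ> \<gamma>)" and ph: "path (h \<circ> \<gamma>)" and pP: "path (P \<circ> \<gamma>)"
      using path_continuous_image g(1) cv ch P(1) by auto
    have pe: "path (\<lambda>t. exp ((P \<circ> \<gamma>) t) * (v \<circ> \<gamma>) t)"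
      using pv pP unfolding path_def
      by (intro continuous_on_mult continuous_on_exp)
    have loops: "pathfinish (f \<circ> \<gamma>) = pathstart (f \<circ> \<gamma>)" for f :: "complex \<Rightarrow> complex"
      using g(2) by (simp add: pathfinish_compose pathstart_compose)
    have "winding_number (\<lambda>t. exp ((P \<circ> \<gamma>) t) * (v \<circ> \<gamma>) t) 0 = winding_number (h \<circ> \<gamma>) 0"
    proof (rule winding_number_nearby_loops_eq[OF ph pe])
      show "pathfinish (\<lambda>t. exp ((P \<circ> \<gamma>) t) * (v \<circ> \<gamma>) t) = pathstart (\<lambda>t. exp ((P \<circ> \<gamma>) t) * (v \<circ> \<gamma>) t)"
        using g(2) by (simp add: pathfinish_def pathstart_def)
      fix t :: real assume "t \<in> {0..1}"
      then have "\<gamma> t \<in> ?S" by (simp add: path_image_def)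
      then show "norm (exp ((P \<circ> \<gamma>) t) * (v \<circ> \<gamma>) t - (h \<circ> \<gamma>) t) < norm ((h \<circ> \<gamma>) t - 0)"
        using P(2) z0(2) by fastforce
    qed (rule loops)
    moreover have "winding_number (\<lambda>t. exp ((P \<circ> \<gamma>) t) * (v \<circ> \<gamma>) t) 0 = winding_number (v \<circ> \<gamma>) 0"
      using g(4) by (intro winding_number_mult_exp pv pP loops) (unfold path_image_compose)
    ultimately show ?thesis by simp
  qed
  with h zeros show ?thesis by (rule that)
qed

section \<open>The argument principle on rectangles\<close>

text \<open>The winding number of the image curve is the integral of \<open>h' / h\<close> over
  \<open>2 \<pi> \<i>\<close>, hence the sum of the orders of the zeros inside the rectangle. There
  are no poles, so every summand is positive.\<close>

lemma holomorphic_rectangle_winding: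
  assumes h: "h holomorphic_on ball 0 R" and r: "r < R" and sub: "cbox a c \<subseteq> ball 0 r"
    and less: "Re a < Re c" "Im a < Im c" and nz: "\<And>z. z \<in> path_image (rectpath a c) \<Longrightarrow> h z \<noteq> 0"
  shows "Re (winding_number (h \<circ> rectpath a c) 0) \<ge> 0"
    and "z \<in> box a c \<Longrightarrow> h z = 0 \<Longrightarrow> Re (winding_number (h \<circ> rectpath a c) 0) > 0"
proof -
  let ?\<gamma> = "rectpath a c"
  define Z where "Z = {w \<in> ball 0 r. h w = 0}"
  have img: "path_image ?\<gamma> \<subseteq> cbox a c"
    using less by (intro path_image_rectpath_subset_cbox) auto
  have a_img: "a \<in> path_image ?\<gamma>" by (metis pathstart_in_path_image pathstart_rectpath)
  have br: "ball 0 r \<subseteq> ball (0::complex) R" "cball 0 r \<subseteq> ball (0::complex) R" using r by auto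
  have aR: "a \<in> ball 0 r" "a \<in> ball 0 R" "h a \<noteq> 0" using subsetD[OF sub subsetD[OF img a_img]] subsetD[OF br(1)] nz[OF a_img] by auto
  have hr: "h holomorphic_on ball 0 r" by (rule holomorphic_on_subset[OF h br(1)])
  \<comment> \<open>Two radii are used here: \<open>cball 0 r\<close> is compact in the domain
    \<open>ball 0 R\<close>, so a nonconstant \<open>h\<close> has finitely many zeros in it. A
    constant \<open>h\<close> has none, because it is nonzero at the corner
    \<open>a\<close>.\<close>
  have finZ: "finite Z"
  proof (cases "h constant_on ball 0 R")
    case True
    then obtain k where k: "\<And>z. z \<in> ball 0 R \<Longrightarrow> h z = k" unfolding constant_on_def by auto
    have "h w \<noteq> 0" if "w \<in> ball 0 r" for w
      using k[OF aR(2)] k[of w] aR(3) that br(1) by auto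
    then have "Z = {}" unfolding Z_def by auto
    then show ?thesis by simp
  next
    case False
    then have "finite {z \<in> cball 0 r. h z = 0}"
      using h br by (intro holomorphic_compact_finite_zeros[of h "ball 0 R"]) auto
    then show ?thesis unfolding Z_def by (rule rev_finite_subset) auto
  qed
  have hom: "\<forall>z. z \<notin> ball 0 r \<longrightarrow> winding_number ?\<gamma> z = 0"
    using sub less by (auto intro!: winding_number_rectpath_outside)
  have "contour_integral ?\<gamma> (\<lambda>x. deriv h x * 1 / h x) = 2 * pi * \<i> * (\<Sum>p\<in>{w\<in>ball 0 r. h w = 0 \<or> w \<in> {}}. winding_number ?\<gamma> p * 1 * zorder h p)"
  proof (rule argument_principle[of "ball 0 r" h "{}" "\<lambda>_. 1"])
    show "path_image ?\<gamma> \<subseteq> ball 0 r - {w \<in> ball 0 r. h w = 0 \<or> w \<in> {}}" using img sub nz by auto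
    show "finite {w \<in> ball 0 r. h w = 0 \<or> w \<in> {}}" using finZ by (simp add: Z_def)
  qed (use hr hom in \<open>auto simp: connected_ball\<close>)
  then have ap: "contour_integral ?\<gamma> (\<lambda>x. deriv h x / h x) = 2 * pi * \<i> * (\<Sum>p\<in>Z. winding_number ?\<gamma> p * zorder h p)"
    by (simp add: Z_def)
  have "valid_path (h \<circ> ?\<gamma>)"
    by (rule valid_path_compose_holomorphic[OF _ hr]) (use img sub in auto)
  moreover have "0 \<notin> path_image (h \<circ> ?\<gamma>)" unfolding path_image_compose using nz by force
  ultimately have "winding_number (h \<circ> ?\<gamma>) 0 = 1/(2*pi*\<i>) * contour_integral (h \<circ> ?\<gamma>) (\<lambda>w. 1/(w - 0))"
    by (rule winding_number_valid_path)
  also have "contour_integral (h \<circ> ?\<gamma>) (\<lambda>w. 1/(w - 0)) = contour_integral ?\<gamma> (\<lambda>w. deriv h w * (1 / (h w - 0)))"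
    by (rule contour_integral_comp_analyticW[of h "ball 0 r"]) (use hr img sub in \<open>auto simp: analytic_on_open\<close>)
  finally have W: "winding_number (h \<circ> ?\<gamma>) 0 = (\<Sum>p\<in>Z. winding_number ?\<gamma> p * zorder h p)"
    using ap by (simp add: o_def)
  \<comment> \<open>The corner \<open>a\<close> also shows that \<open>h\<close> does not vanish
    identically on the connected ball, so each zero has a finite positive order.\<close>
  have ord: "zorder h p > 0" if "p \<in> Z" for p
    using zorder_exist_zero[OF hr open_ball connected_ball, of p] that bexI[of "\<lambda>w. h w \<noteq> 0", OF aR(3,1)]
    by (simp add: Z_def)
  have wn: "winding_number ?\<gamma> p = (if p \<in> box a c then 1 else 0)" if "p \<in> Z" for p
  proof (cases "p \<in> box a c")
    case False
    have "p \<notin> path_image ?\<gamma>" using that nz by (auto simp: Z_def)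
    then have "p \<notin> cbox a c"
      using False path_image_rectpath_cbox_minus_box[of a c] less by auto
    then show ?thesis using False less by (simp add: winding_number_rectpath_outside)
  qed (simp add: winding_number_rectpath)
  have ReW: "Re (winding_number (h \<circ> ?\<gamma>) 0) = (\<Sum>p\<in>Z. if p \<in> box a c then of_int (zorder h p) else 0)"
    unfolding W Re_sum by (rule sum.cong) (auto simp: wn)
  show "Re (winding_number (h \<circ> ?\<gamma>) 0) \<ge> 0"
    unfolding ReW using ord by (intro sum_nonneg) (auto simp: less_imp_le)
  show "Re (winding_number (h \<circ> ?\<gamma>) 0) > 0" if "z \<in> box a c" "h z = 0"
    unfolding ReW
  proof (rule sum_pos2[OF finZ])
    show "z \<in> Z" using that sub box_subset_cbox[of a c] by (auto simp: Z_def)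
    then show "0 < (if z \<in> box a c then real_of_int (zorder h z) else 0)" using ord that by simp
  qed (use ord in \<open>auto simp: less_imp_le\<close>)
qed

text \<open>The balls may be arbitrarily large, so that a rectangle can be treated in one piece.\<close>

definition holomorphic_like :: "(complex \<Rightarrow> complex) \<Rightarrow> bool" where
  "holomorphic_like W \<longleftrightarrow> continuous_on UNIV W \<and> (\<forall>r>0. \<exists>h. h holomorphic_on ball 0 r \<and>
     (\<forall>z\<in>ball 0 r. h z = 0 \<longleftrightarrow> W z = 0) \<and>
     (\<forall>\<gamma>. path \<gamma> \<longrightarrow> pathfinish \<gamma> = pathstart \<gamma> \<longrightarrow> path_image \<gamma> \<subseteq> ball 0 r \<longrightarrow>
        0 \<notin> W ` path_image \<gamma> \<longrightarrow> winding_number (W \<circ> \<gamma>) 0 = winding_number (h \<circ> \<gamma>) 0))"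

lemma holomorphic_like_wirtinger:
  assumes v: "wirtinger UNIV v a b"
    and bv: "\<And>R. \<exists>M. \<forall>z\<in>cball 0 R. norm (b z) \<le> M * norm (v z)"
  shows "holomorphic_like v"
  unfolding holomorphic_like_def
proof (intro conjI allI impI)
  show "continuous_on UNIV v" by (rule wirtinger_continuous[OF v])
  fix r :: real assume r: "r > 0"
  obtain M where M: "\<And>z. z \<in> cball 0 (r + 1) \<Longrightarrow> norm (b z) \<le> M * norm (v z)"
    using bv by blast
  obtain h where h: "h holomorphic_on ball 0 r" "\<And>z. z \<in> ball 0 r \<Longrightarrow> h z = 0 \<longleftrightarrow> v z = 0"
    "\<And>\<gamma>. path \<gamma> \<Longrightarrow> pathfinish \<gamma> = pathstart \<gamma> \<Longrightarrow> path_image \<gamma> \<subseteq> ball 0 r \<Longrightarrow>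
      0 \<notin> v ` path_image \<gamma> \<Longrightarrow> winding_number (v \<circ> \<gamma>) 0 = winding_number (h \<circ> \<gamma>) 0"
    by (rule similarity_holomorphic[OF v _ r _ M]) auto
  show "\<exists>h. h holomorphic_on ball 0 r \<and> (\<forall>z\<in>ball 0 r. h z = 0 \<longleftrightarrow> v z = 0) \<and>
     (\<forall>\<gamma>. path \<gamma> \<longrightarrow> pathfinish \<gamma> = pathstart \<gamma> \<longrightarrow> path_image \<gamma> \<subseteq> ball 0 r \<longrightarrow>
        0 \<notin> v ` path_image \<gamma> \<longrightarrow> winding_number (v \<circ> \<gamma>) 0 = winding_number (h \<circ> \<gamma>) 0)"
    by (rule exI[of _ h]) (simp add: h)
qed

text \<open>\<open>v\<close> is the image of \<open>W\<close> under the real-linear map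
  \<open>x + \<i> y \<mapsto> x + \<kappa> y\<close>, whose determinant is
  \<open>Im \<kappa> > 0\<close>. Moving \<open>\<kappa>\<close> to \<open>\<i>\<close> along a
  segment in the upper half plane deforms this map to the identity through invertible maps, so zeros
  and winding numbers agree.\<close>

lemma holomorphic_like_frame:
  assumes v: "holomorphic_like v" and W: "continuous_on UNIV W" and pos: "\<And>z. Im (\<kappa> z) > 0"
    and vW: "\<And>z. v z = of_real (Re (W z)) + \<kappa> z * of_real (Im (W z))"
  shows "holomorphic_like W"
proof -
  have nz: "of_real x + k * of_real y = 0 \<longleftrightarrow> x = 0 \<and> y = 0" if "Im k > 0" for x y and k :: complex
    using that by (auto simp: complex_eq_iff)
  have zeros: "v z = 0 \<longleftrightarrow> W z = 0" for z
    unfolding vW using nz[OF pos[of z]] by (auto simp: complex_eq_iff)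
  have cv: "continuous_on UNIV v" using v by (simp add: holomorphic_like_def)
  have wn: "winding_number (W \<circ> \<gamma>) 0 = winding_number (v \<circ> \<gamma>) 0"
    if g: "path \<gamma>" "pathfinish \<gamma> = pathstart \<gamma>" "0 \<notin> W ` path_image \<gamma>" for \<gamma>
  proof (rule winding_number_homotopic_loops, rule homotopic_loops_linear)
    show "path (W \<circ> \<gamma>)" "path (v \<circ> \<gamma>)"
      by (auto intro!: path_continuous_image[OF g(1)] continuous_on_subset[OF W] continuous_on_subset[OF cv])
    fix t :: real assume t: "t \<in> {0..1}"
    have W0: "W (\<gamma> t) \<noteq> 0" using g(3) t by (auto simp: path_image_def)
    show "closed_segment ((W \<circ> \<gamma>) t) ((v \<circ> \<gamma>) t) \<subseteq> - {0}"
    proof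
      fix x assume "x \<in> closed_segment ((W \<circ> \<gamma>) t) ((v \<circ> \<gamma>) t)"
      then obtain u where u: "0 \<le> u" "u \<le> 1" "x = (1 - u) *\<^sub>R W (\<gamma> t) + u *\<^sub>R v (\<gamma> t)"
        by (auto simp: closed_segment_def)
      define k where "k = (1 - u) *\<^sub>R \<i> + u *\<^sub>R \<kappa> (\<gamma> t)"
      have "x = of_real (Re (W (\<gamma> t))) + k * of_real (Im (W (\<gamma> t)))"
        unfolding u(3) vW k_def by (simp add: complex_eq_iff algebra_simps)
      moreover have "Im k > 0"
      proof (cases "u = 0")
        case False
        then have "u * Im (\<kappa> (\<gamma> t)) > 0" using u pos by simp
        then show ?thesis using u by (simp add: k_def)
      qed (simp add: k_def)
      ultimately show "x \<in> - {0}" using nz W0 by (simp add: complex_eq_iff)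
    qed
  qed (use g in \<open>auto simp: pathfinish_compose pathstart_compose\<close>)
  show ?thesis
    unfolding holomorphic_like_def
  proof (intro conjI allI impI W)
    fix r :: real assume "r > 0"
    with v obtain h where h: "h holomorphic_on ball 0 r" "\<forall>z\<in>ball 0 r. h z = 0 \<longleftrightarrow> v z = 0"
      "\<forall>\<gamma>. path \<gamma> \<longrightarrow> pathfinish \<gamma> = pathstart \<gamma> \<longrightarrow> path_image \<gamma> \<subseteq> ball 0 r \<longrightarrow>
        0 \<notin> v ` path_image \<gamma> \<longrightarrow> winding_number (v \<circ> \<gamma>) 0 = winding_number (h \<circ> \<gamma>) 0"
      unfolding holomorphic_like_def by meson
    have v0: "0 \<notin> v ` S \<longleftrightarrow> 0 \<notin> W ` S" for S 
      by (simp add: image_iff eq_commute[of 0] zeros)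
    show "\<exists>h. h holomorphic_on ball 0 r \<and> (\<forall>z\<in>ball 0 r. h z = 0 \<longleftrightarrow> W z = 0) \<and>
     (\<forall>\<gamma>. path \<gamma> \<longrightarrow> pathfinish \<gamma> = pathstart \<gamma> \<longrightarrow> path_image \<gamma> \<subseteq> ball 0 r \<longrightarrow>
        0 \<notin> W ` path_image \<gamma> \<longrightarrow> winding_number (W \<circ> \<gamma>) 0 = winding_number (h \<circ> \<gamma>) 0)"
      using h zeros v0 wn by (intro exI[of _ h]) simp
  qed
qed

text \<open>The holomorphic model is taken on a ball containing both \<open>K\<close> and
  \<open>z1\<close>; thus \<open>z1\<close> may lie outside \<open>K\<close> and still rule out a
  model that vanishes identically.\<close>

lemma holomorphic_like_finite_zeros:
  assumes W: "holomorphic_like W" and K: "compact K" and z: "W z1 \<noteq> 0"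
  shows "finite {z \<in> K. W z = 0}"
proof -
  have "bounded (insert z1 K)" using K compact_imp_bounded by auto
  then obtain r where r: "r > 0" "insert z1 K \<subseteq> ball 0 r"
    by (meson bounded_subset_ballD)
  with W obtain h where h: "h holomorphic_on ball 0 r" "\<forall>z\<in>ball 0 r. h z = 0 \<longleftrightarrow> W z = 0"
    unfolding holomorphic_like_def by meson
  have "finite {z \<in> K. h z = 0}"
  proof (cases "h constant_on ball 0 r")
    case True
    then have "{z \<in> K. h z = 0} = {}" using r h z unfolding constant_on_def by fastforce
    then show ?thesis by (simp only: finite.emptyI)
  next
    case False
    then show ?thesis
      using h r K by (intro holomorphic_compact_finite_zeros[of h "ball 0 r"]) auto
  qed
  moreover have "{z \<in> K. h z = 0} = {z \<in> K. W z = 0}" using h r by auto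
  ultimately show ?thesis by simp
qed

lemma holomorphic_like_rectangle_winding:
  assumes W: "holomorphic_like W" and less: "Re a < Re c" "Im a < Im c"
    and nz: "\<And>z. z \<in> path_image (rectpath a c) \<Longrightarrow> W z \<noteq> 0"
  shows "Re (winding_number (W \<circ> rectpath a c) 0) \<ge> 0"
    and "z \<in> box a c \<Longrightarrow> W z = 0 \<Longrightarrow> Re (winding_number (W \<circ> rectpath a c) 0) > 0"
proof -
  obtain r where r: "r > 0" "cbox a c \<subseteq> ball 0 r"
    by (meson bounded_cbox bounded_subset_ballD)
  \<comment> \<open>The margin \<open>1\<close> makes \<open>cball 0 r\<close> a compact subset of
    the ball on which \<open>h\<close> is holomorphic.\<close>
  have "r + 1 > 0" using r by simp
  with W obtain h where h: "h holomorphic_on ball 0 (r + 1)" "\<forall>z\<in>ball 0 (r + 1). h z = 0 \<longleftrightarrow> W z = 0"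
    "\<forall>\<gamma>. path \<gamma> \<longrightarrow> pathfinish \<gamma> = pathstart \<gamma> \<longrightarrow> path_image \<gamma> \<subseteq> ball 0 (r + 1) \<longrightarrow>
        0 \<notin> W ` path_image \<gamma> \<longrightarrow> winding_number (W \<circ> \<gamma>) 0 = winding_number (h \<circ> \<gamma>) 0"
    unfolding holomorphic_like_def by meson
  have img: "path_image (rectpath a c) \<subseteq> cbox a c"
    using less by (intro path_image_rectpath_subset_cbox) auto
  have sub: "cbox a c \<subseteq> ball 0 (r + 1)" using r by force
  have 0: "0 \<notin> W ` path_image (rectpath a c)" using nz by force
  have "winding_number (W \<circ> rectpath a c) 0 = winding_number (h \<circ> rectpath a c) 0"
    using h(3) img sub 0 by (simp add: subset_trans[OF img sub])
  moreover have hnz: "h z \<noteq> 0" if "z \<in> path_image (rectpath a c)" for z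
    using nz[OF that] h(2) that img sub by blast
  moreover have "z \<in> box a c \<Longrightarrow> W z = 0 \<Longrightarrow> h z = 0"
    using h(2) sub box_subset_cbox[of a c] by blast
  ultimately show "Re (winding_number (W \<circ> rectpath a c) 0) \<ge> 0"
    and "z \<in> box a c \<Longrightarrow> W z = 0 \<Longrightarrow> Re (winding_number (W \<circ> rectpath a c) 0) > 0"
    using holomorphic_rectangle_winding[OF h(1) _ r(2) less hnz] by auto
qed

section \<open>Differences of solutions\<close>

lemma Ck_on_1D:
  assumes "Ck_on 1 f U"
  shows "x \<in> U \<Longrightarrow> (f has_derivative frechet_derivative f (at x)) (at x)"
    and "continuous_on U (\<lambda>x. frechet_derivative f (at x) v)"
  using assms by (auto simp: frechet_derivative_works)

text \<open>Boundedness is included in order to have closure under products.\<close>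

definition disc_lipschitz :: "(real \<Rightarrow> complex \<Rightarrow> 'b::real_normed_vector) \<Rightarrow> bool" where
  "disc_lipschitz f \<longleftrightarrow> (\<forall>T. \<exists>L. \<forall>t\<in>{-T..T}. \<forall>x\<in>cball 0 1. \<forall>y\<in>cball 0 1.
     norm (f t x) \<le> L \<and> norm (f t x - f t y) \<le> L * norm (x - y))"

lemma disc_lipschitz_cong:
  "(\<And>t x. norm x \<le> 1 \<Longrightarrow> f t x = g t x) \<Longrightarrow> disc_lipschitz f \<longleftrightarrow> disc_lipschitz g"
  by (simp add: disc_lipschitz_def)

lemma disc_lipschitz_add:
  assumes "disc_lipschitz f" "disc_lipschitz g"
  shows "disc_lipschitz (\<lambda>t x. f t x + g t x)"
  unfolding disc_lipschitz_def
proof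
  fix T
  obtain L where L: "\<forall>t\<in>{-T..T}. \<forall>x\<in>cball 0 1. \<forall>y\<in>cball 0 1. norm (f t x) \<le> L \<and> norm (f t x - f t y) \<le> L * norm (x - y)"
    using assms(1) unfolding disc_lipschitz_def by blast
  obtain M where M: "\<forall>t\<in>{-T..T}. \<forall>x\<in>cball 0 1. \<forall>y\<in>cball 0 1. norm (g t x) \<le> M \<and> norm (g t x - g t y) \<le> M * norm (x - y)"
    using assms(2) unfolding disc_lipschitz_def by blast
  show "\<exists>L. \<forall>t\<in>{-T..T}. \<forall>x\<in>cball 0 1. \<forall>y\<in>cball 0 1. norm (f t x + g t x) \<le> L \<and>
     norm (f t x + g t x - (f t y + g t y)) \<le> L * norm (x - y)"
  proof (intro exI[of _ "L + M"] ballI conjI)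
    fix t and x y :: complex assume *: "t \<in> {-T..T}" "x \<in> cball 0 1" "y \<in> cball 0 1"
    show "norm (f t x + g t x) \<le> L + M"
      using L M * by (meson norm_triangle_mono)
    have "f t x + g t x - (f t y + g t y) = (f t x - f t y) + (g t x - g t y)" by simp
    also have "norm \<dots> \<le> L * norm (x - y) + M * norm (x - y)"
      using L M * by (meson norm_triangle_mono)
    finally show "norm (f t x + g t x - (f t y + g t y)) \<le> (L + M) * norm (x - y)"
      by (simp add: distrib_right)
  qed
qed

lemma disc_lipschitz_mult:
  fixes f g :: "real \<Rightarrow> complex \<Rightarrow> 'b::real_normed_algebra"
  assumes "disc_lipschitz f" "disc_lipschitz g"
  shows "disc_lipschitz (\<lambda>t x. f t x * g t x)"
  unfolding disc_lipschitz_def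
proof
  fix T
  obtain L where L: "\<forall>t\<in>{-T..T}. \<forall>x\<in>cball 0 1. \<forall>y\<in>cball 0 1. norm (f t x) \<le> L \<and> norm (f t x - f t y) \<le> L * norm (x - y)"
    using assms(1) unfolding disc_lipschitz_def by blast
  obtain M where M: "\<forall>t\<in>{-T..T}. \<forall>x\<in>cball 0 1. \<forall>y\<in>cball 0 1. norm (g t x) \<le> M \<and> norm (g t x - g t y) \<le> M * norm (x - y)"
    using assms(2) unfolding disc_lipschitz_def by blast
  show "\<exists>L. \<forall>t\<in>{-T..T}. \<forall>x\<in>cball 0 1. \<forall>y\<in>cball 0 1. norm (f t x * g t x) \<le> L \<and>
     norm (f t x * g t x - f t y * g t y) \<le> L * norm (x - y)"
  proof (intro exI[of _ "2 * L * M"] ballI conjI)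
    fix t and x y :: complex assume *: "t \<in> {-T..T}" "x \<in> cball 0 1" "y \<in> cball 0 1"
    have f: "norm (f t x) \<le> L" "norm (f t x - f t y) \<le> L * norm (x - y)"
      and g: "norm (g t x) \<le> M" "norm (g t y) \<le> M" "norm (g t x - g t y) \<le> M * norm (x - y)"
      using L M * by blast+
    have LM: "0 \<le> L" "0 \<le> M" using f(1) g(1) norm_ge_zero order_trans by blast+
    have "norm (f t x * g t x) \<le> L * M"
      using f g LM by (intro order_trans[OF norm_mult_ineq] mult_mono) auto
    then show "norm (f t x * g t x) \<le> 2 * L * M"
      using mult_nonneg_nonneg[OF LM] by simp
    have "f t x * g t x - f t y * g t y = f t x * (g t x - g t y) + (f t x - f t y) * g t y"
      by (simp add: algebra_simps)
    also have "norm \<dots> \<le> L * (M * norm (x - y)) + (L * norm (x - y)) * M"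
      using f g LM
      by (intro norm_triangle_mono order_trans[OF norm_mult_ineq] mult_mono) auto
    finally show "norm (f t x * g t x - f t y * g t y) \<le> 2 * L * M * norm (x - y)"
      by (simp add: mult_ac)
  qed
qed

lemma disc_lipschitz_linear:
  assumes h: "bounded_linear h" and f: "disc_lipschitz f"
  shows "disc_lipschitz (\<lambda>t x. h (f t x))"
  unfolding disc_lipschitz_def
proof
  fix T
  interpret bounded_linear h by fact
  obtain B where B: "B > 0" "\<And>x. norm (h x) \<le> norm x * B" using pos_bounded by blast
  obtain L where L: "\<forall>t\<in>{-T..T}. \<forall>x\<in>cball 0 1. \<forall>y\<in>cball 0 1. norm (f t x) \<le> L \<and> norm (f t x - f t y) \<le> L * norm (x - y)"
    using f unfolding disc_lipschitz_def by blast
  show "\<exists>L. \<forall>t\<in>{-T..T}. \<forall>x\<in>cball 0 1. \<forall>y\<in>cball 0 1. norm (h (f t x)) \<le> L \<and>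
     norm (h (f t x) - h (f t y)) \<le> L * norm (x - y)"
  proof (intro exI[of _ "L * B"] ballI conjI)
    fix t and x y :: complex assume *: "t \<in> {-T..T}" "x \<in> cball 0 1" "y \<in> cball 0 1"
    show "norm (h (f t x)) \<le> L * B"
      using L B * by (meson mult_right_mono order_trans less_imp_le)
    have "norm (h (f t x - f t y)) \<le> (L * norm (x - y)) * B"
      using L B * by (meson mult_right_mono order_trans less_imp_le)
    then show "norm (h (f t x) - h (f t y)) \<le> L * B * norm (x - y)"
      by (simp add: diff mult_ac)
  qed
qed

text \<open>\<open>Ck_on\<close> gives continuity of the derivative only in each fixed direction.
  Expanding in a basis turns statements about varying directions into statements about three fixed
  ones.\<close>

lemma linear_real_complex_expand:
  fixes D :: "real \<times> complex \<Rightarrow> 'b::real_normed_vector"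
  assumes "linear D"
  shows "D (a, w) = a *\<^sub>R D (1, 0) + Re w *\<^sub>R D (0, 1) + Im w *\<^sub>R D (0, \<i>)"
proof -
  have "(a, w) = a *\<^sub>R (1, 0) + Re w *\<^sub>R (0, 1) + Im w *\<^sub>R (0, \<i>)"
    by (simp add: complex_eq_iff)
  then have "D (a, w) = D (a *\<^sub>R (1, 0) + Re w *\<^sub>R (0, 1) + Im w *\<^sub>R (0, \<i>))" by (rule arg_cong)
  then show ?thesis by (simp only: linear_add[OF assms] linear_cmul[OF assms])
qed

text \<open>For fixed \<open>t\<close> this is the mean value inequality on the convex disc; the
  derivatives in the two disc directions are bounded on the compact set \<open>[-T, T]\<close> times
  the disc.\<close>

lemma disc_lipschitz_C1:
  fixes F :: "real \<times> complex \<Rightarrow> 'b::real_normed_vector"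
  assumes F: "Ck_on 1 F U" and U: "UNIV \<times> cball 0 1 \<subseteq> U"
  shows "disc_lipschitz (\<lambda>t x. F (t, x))"
  unfolding disc_lipschitz_def
proof
  fix T :: real
  let ?K = "{-T..T} \<times> cball (0::complex) 1"
  let ?F' = "\<lambda>p. frechet_derivative F (at p)"
  have K: "compact ?K" "?K \<subseteq> U" using U by (auto intro: compact_Times)
  have bd: "\<exists>L. \<forall>p\<in>?K. norm (f p) \<le> L" if "continuous_on U f" for f :: "real \<times> complex \<Rightarrow> 'b"
    using compact_imp_bounded[OF compact_continuous_image[OF continuous_on_subset[OF that K(2)] K(1)]]
    by (auto simp: bounded_iff)
  have der: "(F has_derivative ?F' p) (at p)" if "p \<in> U" for p
    by (rule Ck_on_1D(1)[OF F that])
  have "continuous_on U F"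
    using der by (meson continuous_at_imp_continuous_on has_derivative_continuous)
  then obtain L0 where L0: "\<forall>p\<in>?K. norm (F p) \<le> L0" using bd by blast
  obtain L1 where L1: "\<forall>p\<in>?K. norm (?F' p (0, 1)) \<le> L1" using bd[OF Ck_on_1D(2)[OF F]] by blast
  obtain L2 where L2: "\<forall>p\<in>?K. norm (?F' p (0, \<i>)) \<le> L2" using bd[OF Ck_on_1D(2)[OF F]] by blast
  show "\<exists>L. \<forall>t\<in>{-T..T}. \<forall>x\<in>cball 0 1. \<forall>y\<in>cball 0 1. norm (F (t, x)) \<le> L \<and>
     norm (F (t, x) - F (t, y)) \<le> L * norm (x - y)"
  proof (intro exI[of _ "max L0 (L1 + L2)"] ballI conjI)
    fix t and x y :: complex assume *: "t \<in> {-T..T}" "x \<in> cball 0 1" "y \<in> cball 0 1"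
    show "norm (F (t, x)) \<le> max L0 (L1 + L2)" using L0 * by (simp add: max.coboundedI1)
    have "norm (F (t, x) - F (t, y)) \<le> (L1 + L2) * norm (x - y)"
    proof (rule differentiable_bound[OF convex_cball _ _ *(2,3)])
      fix z :: complex assume z: "z \<in> cball 0 1"
      have zK: "(t, z) \<in> ?K" using z * by auto
      have dF: "(F has_derivative ?F' (t, z)) (at (t, z))" using der zK K(2) by blast
      have "((\<lambda>z. (t, z)) has_derivative (\<lambda>X. (0, X))) (at z within cball 0 1)"
        by (auto intro!: derivative_eq_intros)
      from has_derivative_compose[OF this dF]
      show "((\<lambda>x. F (t, x)) has_derivative (\<lambda>X. ?F' (t, z) (0, X))) (at z within cball 0 1)" .
      show "onorm (\<lambda>X. ?F' (t, z) (0, X)) \<le> L1 + L2"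
      proof (rule onorm_le)
        fix X :: complex
        have "?F' (t, z) (0, X) = Re X *\<^sub>R ?F' (t, z) (0, 1) + Im X *\<^sub>R ?F' (t, z) (0, \<i>)"
          using linear_real_complex_expand[OF has_derivative_linear[OF dF], of 0 X] by simp
        also have "norm \<dots> \<le> norm X * L1 + norm X * L2"
          using L1 L2 zK abs_Re_le_cmod[of X] abs_Im_le_cmod[of X]
          by (intro norm_triangle_mono) (auto intro!: mult_mono)
        finally show "norm (?F' (t, z) (0, X)) \<le> (L1 + L2) * norm X"
          by (simp add: algebra_simps)
      qed
    qed
    also have "\<dots> \<le> max L0 (L1 + L2) * norm (x - y)" by (intro mult_right_mono) auto
    finally show "norm (F (t, x) - F (t, y)) \<le> max L0 (L1 + L2) * norm (x - y)" .
  qed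
qed

lemma disc_lipschitz_smooth:
  assumes "smooth_on (UNIV \<times> cball 0 1) (\<lambda>(t, x). f t x)"
  shows "disc_lipschitz f"
proof -
  obtain U F where F: "UNIV \<times> cball 0 1 \<subseteq> U" "\<And>k. Ck_on k F U" "\<And>t x. norm x \<le> 1 \<Longrightarrow> F (t, x) = f t x"
    using assms unfolding smooth_on_def by fastforce
  from disc_lipschitz_C1[OF F(2,1)] show ?thesis
    using disc_lipschitz_cong[of "\<lambda>t x. F (t, x)" f] F(3) by simp
qed

text \<open>The definite description in \<open>grad\<close> hides the regularity. Inverting
  \<open>J\<close> by \<open>J^2 = -1\<close> makes it explicit: the gradient has real part
  \<open>- dH (J \<i>)\<close> and imaginary part \<open>dH (J 1)\<close>, a polynomial in the
  entries of \<open>J\<close> and the first derivatives of an extension of \<open>H\<close>.\<close>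

lemma disc_lipschitz_grad:
  assumes J: "J \<in> acs_families" and H: "H \<in> Hamiltonians"
  shows "disc_lipschitz (\<lambda>t x. grad (J t x) (H t) x)"
proof -
  obtain U F where U: "UNIV \<times> cball 0 1 \<subseteq> U" and F: "\<And>k. Ck_on k F U"
    and FH: "\<And>t x. norm x \<le> 1 \<Longrightarrow> F (t, x) = H t x"
    using H unfolding Hamiltonians_def smooth_on_def by fastforce
  define d where "d v t x = frechet_derivative F (at (t, x)) (0, v)" for v t x
  \<comment> \<open>Order two: the gradient uses up one derivative, its Lipschitz bound
    another.\<close>
  have "Ck_on (Suc 1) F U" by (rule F)
  then have "Ck_on 1 (\<lambda>p. frechet_derivative F (at p) v) U" for v
    unfolding Ck_on.simps(2) by blast
  then have dl: "disc_lipschitz (d v)" for v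
    unfolding d_def[abs_def] using disc_lipschitz_C1[OF _ U] by blast
  have Jl: "disc_lipschitz J"
    using J by (intro disc_lipschitz_smooth) (simp add: acs_families_def)
  have RJ: "disc_lipschitz (\<lambda>t x. Re (blinfun_apply (J t x) v))"
    and IJ: "disc_lipschitz (\<lambda>t x. Im (blinfun_apply (J t x) v))" for v
    by (intro disc_lipschitz_linear[OF _ Jl] bounded_linear_compose[OF bounded_linear_Re]
        bounded_linear_compose[OF bounded_linear_Im] blinfun.bounded_linear_left)+
  define D where "D v t x = Re (blinfun_apply (J t x) v) * d 1 t x + Im (blinfun_apply (J t x) v) * d \<i> t x" for v t x
  have Dl: "disc_lipschitz (D v)" for v
    unfolding D_def[abs_def] by (intro disc_lipschitz_add disc_lipschitz_mult RJ IJ dl)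
  have "grad (J t x) (H t) x = complex_of_real (- D \<i> t x) + \<i> * complex_of_real (D 1 t x)"
    if x: "norm x \<le> 1" for t x
  proof -
    have xc: "x \<in> cball 0 1" using x by simp
    have A: "compatible_acs (J t x)" using J xc by (simp add: acs_families_def)
    have dF: "(F has_derivative frechet_derivative F (at (t, x))) (at (t, x))"
      using Ck_on_1D(1)[OF F] U xc by blast
    have "((\<lambda>z. (t, z)) has_derivative (\<lambda>X. (0, X))) (at x within cball 0 1)"
      by (auto intro!: derivative_eq_intros)
    from has_derivative_compose[OF this dF]
    have "((\<lambda>z. F (t, z)) has_derivative (\<lambda>v. d v t x)) (at x within cball 0 1)"
      unfolding d_def .
    then have dH: "(H t has_derivative (\<lambda>v. d v t x)) (at x within cball 0 1)"
      by (rule has_derivative_transform[OF xc, rotated]) (simp add: FH)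
    have dexp: "d v t x = Re v * d 1 t x + Im v * d \<i> t x" for v
      using linear_real_complex_expand[OF has_derivative_linear[OF dF], of 0 v] by (simp add: d_def)
    have g: "omega0 (grad (J t x) (H t) x) (blinfun_apply (J t x) v) = d v t x" for v
      using grad_characterization[OF A xc dH] by (simp add: metric_of_def)
    have AA: "blinfun_apply (J t x) (blinfun_apply (J t x) v) = - v" for v
      using A by (simp add: compatible_acs_def)
    \<comment> \<open>Testing with \<open>v = - J \<i>\<close>, for which \<open>J v = \<i>\<close>,
      isolates the real part; \<open>v = - J 1\<close> isolates minus the imaginary part.\<close>
    have "Re (grad (J t x) (H t) x) = - D \<i> t x"
      using g[of "- blinfun_apply (J t x) \<i>"] dexp[of "- blinfun_apply (J t x) \<i>"]
      by (simp add: AA omega0_def D_def blinfun.minus_right)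
    moreover have "Im (grad (J t x) (H t) x) = D 1 t x"
      using g[of "- blinfun_apply (J t x) 1"] dexp[of "- blinfun_apply (J t x) 1"]
      by (simp add: AA omega0_def D_def blinfun.minus_right)
    ultimately show ?thesis by (simp add: complex_eq_iff)
  qed
  moreover have "disc_lipschitz (\<lambda>t x. complex_of_real (- D \<i> t x) + \<i> * complex_of_real (D 1 t x))"
    by (intro disc_lipschitz_add disc_lipschitz_linear[OF bounded_linear_compose[OF bounded_linear_of_real bounded_linear_minus[OF bounded_linear_ident]] Dl]
      disc_lipschitz_linear[OF bounded_linear_compose[OF bounded_linear_mult_right bounded_linear_of_real] Dl])
  ultimately show ?thesis by (simp cong: disc_lipschitz_cong)
qed

section \<open>The equation in the coordinate z = t + i s and in a moving frame\<close>

lemma strand_derivative: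
  assumes u: "u \<in> CR_solutions n J H" and k: "k \<in> {1..n}"
  obtains U' where "\<And>z. ((\<lambda>z. u k (Im z) (Re z)) has_derivative U' z) (at z)"
    "\<And>X. continuous_on UNIV (\<lambda>z. U' z X)"
    "\<And>z. U' z \<i> = blinfun_apply (J (Re z) (u k (Im z) (Re z))) (U' z 1)
        + grad (J (Re z) (u k (Im z) (Re z))) (H (Re z)) (u k (Im z) (Re z))"
proof -
  define f where "f = (\<lambda>(s, t). u k s t)"
  define f' where "f' p = frechet_derivative f (at p)" for p
  have C1: "Ck_on 1 f UNIV" using u k by (simp add: CR_solutions_def f_def)
  have f: "(f has_derivative f' p) (at p)" for p
    unfolding f'_def by (rule Ck_on_1D(1)[OF C1]) simp
  have lin: "linear (f' p)" for p using f by (rule has_derivative_linear)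
  \<comment> \<open>The coordinates are swapped: \<open>U' z 1\<close> is the
    \<open>t\<close>-derivative and \<open>U' z \<i>\<close> the
    \<open>s\<close>-derivative.\<close>
  define U' where "U' z X = f' (Im z, Re z) (Im X, Re X)" for z X
  have U: "((\<lambda>z. u k (Im z) (Re z)) has_derivative U' z) (at z)" for z
  proof -
    have "((\<lambda>z. (Im z, Re z)) has_derivative (\<lambda>X. (Im X, Re X))) (at z)"
      by (auto intro!: derivative_eq_intros)
    from has_derivative_compose[OF this f] show ?thesis by (simp add: f_def U'_def[abs_def])
  qed
  have cont: "continuous_on UNIV (\<lambda>z. U' z X)" for X
    unfolding U'_def f'_def
    by (rule continuous_on_compose2[OF Ck_on_1D(2)[OF C1]]) (auto intro!: continuous_intros)
  have ds: "vector_derivative (\<lambda>s. u k s t) (at s) = f' (s, t) (1, 0)" for s t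
  proof (rule vector_derivative_at)
    have "((\<lambda>s. (s, t)) has_derivative (\<lambda>h. (h, 0))) (at s)"
      by (auto intro!: derivative_eq_intros)
    from has_derivative_compose[OF this f]
    have "((\<lambda>s. u k s t) has_derivative (\<lambda>h. f' (s, t) (h, 0))) (at s)" by (simp add: f_def)
    moreover have "(\<lambda>h. f' (s, t) (h, 0)) = (\<lambda>h. h *\<^sub>R f' (s, t) (1, 0))"
    proof
      show "f' (s, t) (h, 0) = h *\<^sub>R f' (s, t) (1, 0)" for h
        using linear_cmul[OF lin, of "(s, t)" h "(1, 0)"] by simp
    qed
    ultimately show "((\<lambda>s. u k s t) has_vector_derivative f' (s, t) (1, 0)) (at s)"
      by (simp only: has_vector_derivative_def)
  qed
  have dt: "vector_derivative (\<lambda>t. u k s t) (at t) = f' (s, t) (0, 1)" for s t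
  proof (rule vector_derivative_at)
    have "((\<lambda>t. (s, t)) has_derivative (\<lambda>h. (0, h))) (at t)"
      by (auto intro!: derivative_eq_intros)
    from has_derivative_compose[OF this f]
    have "((\<lambda>t. u k s t) has_derivative (\<lambda>h. f' (s, t) (0, h))) (at t)" by (simp add: f_def)
    moreover have "(\<lambda>h. f' (s, t) (0, h)) = (\<lambda>h. h *\<^sub>R f' (s, t) (0, 1))"
    proof
      show "f' (s, t) (0, h) = h *\<^sub>R f' (s, t) (0, 1)" for h
        using linear_cmul[OF lin, of "(s, t)" h "(0, 1)"] by simp
    qed
    ultimately show "((\<lambda>t. u k s t) has_vector_derivative f' (s, t) (0, 1)) (at t)"
      by (simp only: has_vector_derivative_def)
  qed
  have "U' z \<i> = blinfun_apply (J (Re z) (u k (Im z) (Re z))) (U' z 1)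
        + grad (J (Re z) (u k (Im z) (Re z))) (H (Re z)) (u k (Im z) (Re z))" for z
  proof -
    have "vector_derivative (\<lambda>s. u k s t) (at s) - blinfun_apply (J t (u k s t)) (vector_derivative (\<lambda>t. u k s t) (at t))
        - grad (J t (u k s t)) (H t) (u k s t) = 0" for s t
      using u k by (simp add: CR_solutions_def)
    from this[of "Re z" "Im z"] show ?thesis
      unfolding ds dt by (simp add: U'_def algebra_simps)
  qed
  with U cont that show ?thesis by blast
qed

text \<open>In the real basis \<open>1\<close>, \<open>A 1\<close> of the plane, \<open>A\<close> becomes multiplication by \<open>\<i>\<close>: the vector \<open>x\<close> has the
  complex coordinate \<open>Re x + \<kappa> Im x\<close> with \<open>\<kappa> = (\<i> - Re \<beta>) / Im \<beta>\<close>.\<close>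

lemma acs_frame:
  assumes A: "compatible_acs A"
  defines "\<beta> \<equiv> blinfun_apply A 1"
  shows "Im \<beta> > 0"
    and "Re (blinfun_apply A x) + (\<i> - Re \<beta>) / Im \<beta> * Im (blinfun_apply A x)
      = \<i> * (Re x + (\<i> - Re \<beta>) / Im \<beta> * Im x)"
proof -
  have "metric_of A 1 1 > 0" using A unfolding compatible_acs_def by (metis zero_neq_one)
  then show pos: "Im \<beta> > 0" by (simp add: metric_of_def omega0_def \<beta>_def)
  have expand: "blinfun_apply A y = Re y *\<^sub>R \<beta> + Im y *\<^sub>R blinfun_apply A \<i>" for y
  proof -
    have "y = Re y *\<^sub>R 1 + Im y *\<^sub>R \<i>" by (simp add: complex_eq_iff)
    then have "blinfun_apply A y = blinfun_apply A (Re y *\<^sub>R 1 + Im y *\<^sub>R \<i>)" by (rule arg_cong)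
    then show ?thesis by (simp only: blinfun.add_right blinfun.scaleR_right \<beta>_def)
  qed
  \<comment> \<open>\<open>A^2 = -1\<close> determines the second column \<open>A \<i>\<close> from
    the first column \<open>\<beta>\<close>; in particular the trace vanishes.\<close>
  have "blinfun_apply A \<beta> = - 1" using A by (simp add: compatible_acs_def \<beta>_def)
  with expand[of \<beta>] have Ai: "Im \<beta> *\<^sub>R blinfun_apply A \<i> = - 1 - Re \<beta> *\<^sub>R \<beta>"
    by (simp add: algebra_simps eq_diff_eq)
  define p q where "p = Re (blinfun_apply A \<i>)" and "q = Im (blinfun_apply A \<i>)"
  have "Im \<beta> * q = Im \<beta> * (- Re \<beta>)"
    using arg_cong[OF Ai, of Im] by (simp add: q_def)
  then have pq: "q = - Re \<beta>"
    unfolding mult_cancel_left using pos by auto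
  have "Im \<beta> * p = - 1 - Re \<beta> * Re \<beta>"
    using arg_cong[OF Ai, of Re] by (simp add: p_def)
  then have pp: "p = (- 1 - Re \<beta> * Re \<beta>) / Im \<beta>" using pos by (simp add: field_simps)
  have R: "Re (blinfun_apply A x) = Re x * Re \<beta> + Im x * p"
    and I: "Im (blinfun_apply A x) = Re x * Im \<beta> + Im x * q"
    unfolding expand[of x] by (simp_all add: p_def q_def)
  show "Re (blinfun_apply A x) + (\<i> - Re \<beta>) / Im \<beta> * Im (blinfun_apply A x)
      = \<i> * (Re x + (\<i> - Re \<beta>) / Im \<beta> * Im x)"
    unfolding R I pq pp using pos
    by (simp add: complex_eq_iff field_simps Re_divide_of_real Im_divide_of_real)
qed

text \<open>The frame varies with \<open>z\<close>, so its derivative enters dbar of the new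
  coordinate. As \<open>U\<close> may touch the boundary circle, the chain rule is applied to an
  extension of \<open>J\<close> to an open set, which agrees with \<open>J\<close> along the
  strand.\<close>

lemma acs_frame_derivative:
  assumes J: "J \<in> acs_families" and U: "\<And>z. norm (U z) \<le> 1"
    and dU: "\<And>z. (U has_derivative U' z) (at z)" and cU: "\<And>X. continuous_on UNIV (\<lambda>z. U' z X)"
  obtains \<beta>' where "\<And>z. ((\<lambda>z. blinfun_apply (J (Re z) (U z)) 1) has_derivative \<beta>' z) (at z)"
    "\<And>X. continuous_on UNIV (\<lambda>z. \<beta>' z X)"
proof -
  obtain S F where S: "UNIV \<times> cball 0 1 \<subseteq> S" and F: "\<And>k. Ck_on k F S"
    and FJ: "\<And>t x. norm x \<le> 1 \<Longrightarrow> F (t, x) = J t x"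
    using J unfolding acs_families_def smooth_on_def by fastforce
  define p where "p z = (Re z, U z)" for z
  have pS: "p z \<in> S" for z using S U by (auto simp: p_def)
  define F' where "F' q = frechet_derivative F (at q)" for q
  have dF: "(F has_derivative F' (p z)) (at (p z))" for z
    unfolding F'_def by (rule Ck_on_1D(1)[OF F pS])
  have ccU: "continuous_on UNIV U"
    using dU by (meson continuous_at_imp_continuous_on has_derivative_continuous)
  have cp: "continuous_on UNIV p" unfolding p_def by (intro continuous_intros ccU)
  have cF: "continuous_on UNIV (\<lambda>z. F' (p z) v)" for v
    unfolding F'_def by (rule continuous_on_compose2[OF Ck_on_1D(2)[OF F] cp]) (use pS in auto)
  define \<beta>' where "\<beta>' z X = blinfun_apply (F' (p z) (Re X, U' z X)) 1" for z X
  have "((\<lambda>z. blinfun_apply (J (Re z) (U z)) 1) has_derivative \<beta>' z) (at z)" for z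
  proof -
    have "(p has_derivative (\<lambda>X. (Re X, U' z X))) (at z)"
      unfolding p_def using dU by (auto intro!: derivative_eq_intros)
    from has_derivative_compose[OF this dF]
    have "((\<lambda>z. F (p z)) has_derivative (\<lambda>X. F' (p z) (Re X, U' z X))) (at z)" .
    then have "((\<lambda>z. blinfun_apply (F (p z)) 1) has_derivative \<beta>' z) (at z)"
      unfolding \<beta>'_def[abs_def] by (rule bounded_linear.has_derivative[OF blinfun.bounded_linear_left])
    then show ?thesis by (simp add: p_def FJ U)
  qed
  moreover have "continuous_on UNIV (\<lambda>z. \<beta>' z X)" for X
  proof -
    have "\<beta>' z X = blinfun_apply (Re X *\<^sub>R F' (p z) (1, 0) + Re (U' z X) *\<^sub>R F' (p z) (0, 1) + Im (U' z X) *\<^sub>R F' (p z) (0, \<i>)) 1" for z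
      unfolding \<beta>'_def by (subst linear_real_complex_expand[OF has_derivative_linear[OF dF]]) simp
    then show ?thesis
      by (simp only:) (intro continuous_intros cF cU)
  qed
  ultimately show ?thesis using that by blast
qed

lemma wirtinger_from_derivative:
  assumes d: "\<And>z. (f has_derivative f' z) (at z)" and c: "\<And>X. continuous_on UNIV (\<lambda>z. f' z X)"
  shows "wirtinger UNIV f (\<lambda>z. (f' z 1 - \<i> * f' z \<i>) / 2) (\<lambda>z. (f' z 1 + \<i> * f' z \<i>) / 2)"
proof -
  have "f' z X = (f' z 1 - \<i> * f' z \<i>) / 2 * X + (f' z 1 + \<i> * f' z \<i>) / 2 * cnj X" for z X
  proof -
    have lin: "linear (f' z)" using d by (rule has_derivative_linear)
    have "X = Re X *\<^sub>R 1 + Im X *\<^sub>R \<i>" by (simp add: complex_eq_iff)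
    then have "f' z X = f' z (Re X *\<^sub>R 1 + Im X *\<^sub>R \<i>)" by (rule arg_cong)
    then have "f' z X = Re X *\<^sub>R f' z 1 + Im X *\<^sub>R f' z \<i>"
      by (simp only: linear_add[OF lin] linear_cmul[OF lin])
    then show ?thesis by (simp add: complex_eq_iff field_simps)
  qed
  then have "f' z = (\<lambda>X. (f' z 1 - \<i> * f' z \<i>) / 2 * X + (f' z 1 + \<i> * f' z \<i>) / 2 * cnj X)" for z
    by blast
  then have "(f has_derivative (\<lambda>X. (f' z 1 - \<i> * f' z \<i>) / 2 * X + (f' z 1 + \<i> * f' z \<i>) / 2 * cnj X)) (at z)" for z
    by (rule has_derivative_eq_rhs[OF d])
  then show ?thesis unfolding wirtinger_def by (auto intro!: continuous_intros c)
qed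

text \<open>In the variable \<open>z = t + \<i> s\<close>, dbar is \<open>\<i> (\<partial>\<^sub>s - \<i> \<partial>\<^sub>t) / 2\<close>.\<close>

lemma strand_difference_holomorphic_like:
  assumes J: "J \<in> acs_families" and H: "H \<in> Hamiltonians" and u: "u \<in> CR_solutions n J H"
    and k: "k \<in> {1..n}" "k' \<in> {1..n}"
  shows "holomorphic_like (\<lambda>z. u k (Im z) (Re z) - u k' (Im z) (Re z))"
proof -
  define U Y where "U z = u k (Im z) (Re z)" and "Y z = u k' (Im z) (Re z)" for z
  define G where "G t x = grad (J t x) (H t) x" for t x
  obtain U' where dU: "\<And>z. (U has_derivative U' z) (at z)" and cU: "\<And>X. continuous_on UNIV (\<lambda>z. U' z X)"
    and eU: "\<And>z. U' z \<i> = blinfun_apply (J (Re z) (U z)) (U' z 1) + G (Re z) (U z)"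
    unfolding U_def[abs_def] G_def by (rule strand_derivative[OF u k(1)]) blast
  obtain Y' where dY: "\<And>z. (Y has_derivative Y' z) (at z)" and cY: "\<And>X. continuous_on UNIV (\<lambda>z. Y' z X)"
    and eY: "\<And>z. Y' z \<i> = blinfun_apply (J (Re z) (Y z)) (Y' z 1) + G (Re z) (Y z)"
    unfolding Y_def[abs_def] G_def by (rule strand_derivative[OF u k(2)]) blast
  have disc: "norm (U z) \<le> 1" "norm (Y z) \<le> 1" for z
    using u k unfolding CR_solutions_def singular_braids_def U_def Y_def by (auto simp: image_subset_iff)
  define \<beta> where "\<beta> z = blinfun_apply (J (Re z) (U z)) 1" for z
  obtain \<beta>' where d\<beta>: "\<And>z. (\<beta> has_derivative \<beta>' z) (at z)" and c\<beta>: "\<And>X. continuous_on UNIV (\<lambda>z. \<beta>' z X)"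
    unfolding \<beta>_def[abs_def] by (rule acs_frame_derivative[OF J disc(1) dU cU]) blast
  have acs: "compatible_acs (J (Re z) (U z))" for z
    using J disc(1) by (simp add: acs_families_def)
  have pos: "Im (\<beta> z) > 0" for z unfolding \<beta>_def by (rule acs_frame(1)[OF acs])
  have contD: "continuous_on UNIV f" if "\<And>z. (f has_derivative f' z) (at z)" for f :: "complex \<Rightarrow> complex" and f'
    using that by (meson continuous_at_imp_continuous_on has_derivative_continuous)
  define W where "W z = U z - Y z" for z
  define W' where "W' z X = U' z X - Y' z X" for z X
  have dW: "(W has_derivative W' z) (at z)" for z
    unfolding W_def[abs_def] W'_def[abs_def] by (intro has_derivative_diff dU dY)
  have cW': "continuous_on UNIV (\<lambda>z. W' z X)" for X unfolding W'_def by (intro continuous_intros cU cY)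
  have cW: "continuous_on UNIV W" and cbeta: "continuous_on UNIV \<beta>" by (rule contD[OF dW], rule contD[OF d\<beta>])
  define \<kappa> where "\<kappa> z = (\<i> - Re (\<beta> z)) / Im (\<beta> z)" for z
  define \<kappa>' where "\<kappa>' z X = - of_real (Re (\<beta>' z X)) / of_real (Im (\<beta> z))
     - (\<i> - of_real (Re (\<beta> z))) * of_real (Im (\<beta>' z X)) / (of_real (Im (\<beta> z)) * of_real (Im (\<beta> z)))" for z X
  have d\<kappa>: "(\<kappa> has_derivative \<kappa>' z) (at z)" for z
    unfolding \<kappa>_def[abs_def] \<kappa>'_def[abs_def] using pos[of z]
    by (auto intro!: derivative_eq_intros d\<beta> simp: field_simps)
  have pos0: "complex_of_real (Im (\<beta> z)) \<noteq> 0" for z using pos[of z] by simp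
  have c\<kappa>': "continuous_on UNIV (\<lambda>z. \<kappa>' z X)" for X
    unfolding \<kappa>'_def using pos0 by (intro continuous_intros c\<beta> cbeta) auto
  have c\<kappa>: "continuous_on UNIV \<kappa>" by (rule contD[OF d\<kappa>])
  define V where "V z = of_real (Re (W z)) + \<kappa> z * of_real (Im (W z))" for z
  define V' where "V' z X = of_real (Re (W' z X)) + (\<kappa> z * of_real (Im (W' z X)) + \<kappa>' z X * of_real (Im (W z)))" for z X
  have dV: "(V has_derivative V' z) (at z)" for z
    unfolding V_def[abs_def] V'_def[abs_def]
    by (intro has_derivative_add has_derivative_mult has_derivative_of_real has_derivative_Re has_derivative_Im dW d\<kappa>)
  have cV': "continuous_on UNIV (\<lambda>z. V' z X)" for X
    unfolding V'_def by (intro continuous_intros cW cW' c\<kappa> c\<kappa>')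
  \<comment> \<open>The equation bounds errors by \<open>|W|\<close>, the similarity principle wants
    \<open>|V|\<close>. Inverting the frame uses \<open>Im \<kappa> = 1 / Im \<beta>\<close>, hence
    \<open>Im W = Im \<beta> * Im V\<close>.\<close>
  have W_le: "norm (W z) \<le> (1 + norm (\<kappa> z) * norm (\<beta> z) + norm (\<beta> z)) * norm (V z)" for z
  proof -
    have "Im (W z) = Im (\<beta> z) * Im (V z)"
      using pos[of z] by (simp add: V_def \<kappa>_def)
    then have I: "\<bar>Im (W z)\<bar> \<le> norm (\<beta> z) * norm (V z)"
      using abs_Im_le_cmod by (simp add: abs_mult mult_mono)
    have "of_real (Re (W z)) = V z - \<kappa> z * of_real (Im (W z))" by (simp add: V_def)
    then have "norm (complex_of_real (Re (W z))) \<le> norm (V z) + norm (\<kappa> z * of_real (Im (W z)))"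
      by (metis norm_triangle_ineq4)
    also have "norm (\<kappa> z * of_real (Im (W z))) \<le> norm (\<kappa> z) * (norm (\<beta> z) * norm (V z))"
      using I by (simp add: norm_mult mult_left_mono)
    finally have "\<bar>Re (W z)\<bar> \<le> norm (V z) + norm (\<kappa> z) * (norm (\<beta> z) * norm (V z))" by simp
    with I cmod_le[of "W z"] show ?thesis by (simp add: algebra_simps)
  qed
  \<comment> \<open>In the frame \<open>J\<close> is multiplication by \<open>\<i>\<close>, so the
    first-order part of the equation is dbar up to a factor; differentiating the frame adds only a
    term of order zero in \<open>W\<close>.\<close>
  have eq: "V' z \<i> - \<i> * V' z 1 = (Re (W' z \<i> - blinfun_apply (J (Re z) (U z)) (W' z 1))
      + \<kappa> z * Im (W' z \<i> - blinfun_apply (J (Re z) (U z)) (W' z 1))) + (\<kappa>' z \<i> - \<i> * \<kappa>' z 1) * Im (W z)" for z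
  proof -
    have "Re (blinfun_apply (J (Re z) (U z)) (W' z 1)) + \<kappa> z * Im (blinfun_apply (J (Re z) (U z)) (W' z 1))
      = \<i> * (Re (W' z 1) + \<kappa> z * Im (W' z 1))"
      unfolding \<kappa>_def \<beta>_def by (rule acs_frame(2)[OF acs])
    then show ?thesis unfolding V'_def by (simp add: algebra_simps)
  qed
  \<comment> \<open>\<open>J\<close> is evaluated at the first strand throughout; the remaining
    difference of structures acts on the \<open>t\<close>-derivative of the second strand, which is
    locally bounded.\<close>
  have Wpde: "W' z \<i> - blinfun_apply (J (Re z) (U z)) (W' z 1) =
    blinfun_apply (J (Re z) (U z) - J (Re z) (Y z)) (Y' z 1) + (G (Re z) (U z) - G (Re z) (Y z))" for z
    unfolding W'_def eU eY by (simp add: blinfun.diff_left blinfun.diff_right)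
  have "holomorphic_like V"
  proof (rule holomorphic_like_wirtinger[OF wirtinger_from_derivative[OF dV cV']])
    fix R :: real
    have "disc_lipschitz J" using J by (intro disc_lipschitz_smooth) (simp add: acs_families_def)
    then obtain L1 where L1: "\<forall>t\<in>{-R..R}. \<forall>x\<in>cball 0 1. \<forall>y\<in>cball 0 1. norm (J t x) \<le> L1 \<and> norm (J t x - J t y) \<le> L1 * norm (x - y)"
      unfolding disc_lipschitz_def by blast
    have "disc_lipschitz G" unfolding G_def[abs_def] by (rule disc_lipschitz_grad[OF J H])
    then obtain L2 where L2: "\<forall>t\<in>{-R..R}. \<forall>x\<in>cball 0 1. \<forall>y\<in>cball 0 1. norm (G t x) \<le> L2 \<and> norm (G t x - G t y) \<le> L2 * norm (x - y)"
      unfolding disc_lipschitz_def by blast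
    \<comment> \<open>The summands bound the error of the equation in the frame and the derivative
      of the frame; the last factor converts \<open>|W|\<close> into \<open>|V|\<close>. Continuity
      of \<open>m\<close> gives a constant on each ball.\<close>
    define m where "m z = ((1 + norm (\<kappa> z)) * (L1 * norm (Y' z 1) + L2) + (norm (\<kappa>' z \<i>) + norm (\<kappa>' z 1)))
       * (1 + norm (\<kappa> z) * norm (\<beta> z) + norm (\<beta> z))" for z
    have cm: "continuous_on UNIV m"
      unfolding m_def by (intro continuous_intros c\<kappa> c\<kappa>' cY cbeta)
    have "bounded (m ` cball 0 R)"
      by (rule compact_imp_bounded[OF compact_continuous_image[OF continuous_on_subset[OF cm subset_UNIV] compact_cball]])
    then obtain M where M: "\<And>z. z \<in> cball 0 R \<Longrightarrow> norm (m z) \<le> M"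
      unfolding bounded_iff by blast
    have "norm ((V' z 1 + \<i> * V' z \<i>) / 2) \<le> M * norm (V z)" if z: "z \<in> cball 0 R" for z
    proof -
      have t: "Re z \<in> {-R..R}" using z abs_Re_le_cmod[of z] by auto
      define E where "E = W' z \<i> - blinfun_apply (J (Re z) (U z)) (W' z 1)"
      have JL: "norm (J (Re z) (U z) - J (Re z) (Y z)) \<le> L1 * norm (W z)"
        using L1 t disc by (simp add: W_def)
      have GL: "norm (G (Re z) (U z) - G (Re z) (Y z)) \<le> L2 * norm (W z)"
        using L2 t disc by (simp add: W_def)
      have "norm E \<le> (L1 * norm (W z)) * norm (Y' z 1) + L2 * norm (W z)"
        unfolding E_def Wpde
        by (intro norm_triangle_mono GL order_trans[OF norm_blinfun] mult_right_mono JL) auto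
      then have E: "norm E \<le> (L1 * norm (Y' z 1) + L2) * norm (W z)" by (simp add: algebra_simps)
      have "norm (Re E + \<kappa> z * Im E) \<le> norm E + norm (\<kappa> z) * norm E"
        using abs_Re_le_cmod[of E] abs_Im_le_cmod[of E]
        by (intro norm_triangle_mono) (auto simp: norm_mult intro!: mult_left_mono)
      also have "\<dots> = (1 + norm (\<kappa> z)) * norm E" by (simp add: algebra_simps)
      also have "\<dots> \<le> (1 + norm (\<kappa> z)) * ((L1 * norm (Y' z 1) + L2) * norm (W z))"
        by (intro mult_left_mono E) simp
      finally have 1: "norm (Re E + \<kappa> z * Im E) \<le> (1 + norm (\<kappa> z)) * (L1 * norm (Y' z 1) + L2) * norm (W z)"
        by (simp add: mult_ac)
      have "norm (\<kappa>' z \<i> - \<i> * \<kappa>' z 1) \<le> norm (\<kappa>' z \<i>) + norm (\<kappa>' z 1)"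
        using norm_triangle_ineq4[of "\<kappa>' z \<i>" "\<i> * \<kappa>' z 1"] by (simp add: norm_mult)
      then have 2: "norm ((\<kappa>' z \<i> - \<i> * \<kappa>' z 1) * Im (W z)) \<le> (norm (\<kappa>' z \<i>) + norm (\<kappa>' z 1)) * norm (W z)"
        unfolding norm_mult norm_of_real by (intro mult_mono abs_Im_le_cmod) auto
      have "norm (V' z \<i> - \<i> * V' z 1) \<le> ((1 + norm (\<kappa> z)) * (L1 * norm (Y' z 1) + L2)) * norm (W z)
          + (norm (\<kappa>' z \<i>) + norm (\<kappa>' z 1)) * norm (W z)"
        unfolding eq E_def[symmetric] by (intro norm_triangle_mono 1 2)
      also have "\<dots> = ((1 + norm (\<kappa> z)) * (L1 * norm (Y' z 1) + L2) + (norm (\<kappa>' z \<i>) + norm (\<kappa>' z 1))) * norm (W z)"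
        by (simp only: distrib_right)
      also have "\<dots> \<le> ((1 + norm (\<kappa> z)) * (L1 * norm (Y' z 1) + L2) + (norm (\<kappa>' z \<i>) + norm (\<kappa>' z 1)))
          * ((1 + norm (\<kappa> z) * norm (\<beta> z) + norm (\<beta> z)) * norm (V z))"
      proof (intro mult_left_mono W_le)
        have "0 \<le> L1" "0 \<le> L2"
          using L1 L2 t disc(1)[of z] norm_ge_zero order_trans by (meson mem_cball_0)+
        then show "0 \<le> (1 + norm (\<kappa> z)) * (L1 * norm (Y' z 1) + L2) + (norm (\<kappa>' z \<i>) + norm (\<kappa>' z 1))"
          by simp
      qed
      also have "\<dots> = m z * norm (V z)" by (simp only: m_def mult.assoc)
      also have "\<dots> \<le> M * norm (V z)" using M[OF z] by (intro mult_right_mono) auto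
      finally have "norm (V' z \<i> - \<i> * V' z 1) \<le> M * norm (V z)" .
      moreover have "(V' z 1 + \<i> * V' z \<i>) / 2 = \<i> / 2 * (V' z \<i> - \<i> * V' z 1)"
        by (simp add: field_simps)
      then have "norm ((V' z 1 + \<i> * V' z \<i>) / 2) = norm (V' z \<i> - \<i> * V' z 1) / 2"
        by (simp only: norm_mult norm_divide) simp
      ultimately show ?thesis using norm_ge_zero[of "V' z \<i> - \<i> * V' z 1"] by linarith
    qed
    then show "\<exists>M. \<forall>z\<in>cball 0 R. norm ((V' z 1 + \<i> * V' z \<i>) / 2) \<le> M * norm (V z)" by blast
  qed
  then have "holomorphic_like W"
  proof (rule holomorphic_like_frame[OF _ cW])
    show "Im (\<kappa> z) > 0" for z using pos[of z] by (simp add: \<kappa>_def)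
    show "V z = of_real (Re (W z)) + \<kappa> z * of_real (Im (W z))" for z by (rule V_def)
  qed
  then show ?thesis by (simp add: W_def[abs_def] U_def Y_def)
qed

section \<open>Crossing numbers\<close>

text \<open>The rectangle is traversed counterclockwise, hence its top and left sides run backwards
  and count negatively.\<close>

lemma winding_number_compose_rectpath:
  assumes W: "continuous_on UNIV W" and le: "t1 \<le> t2" "s1 \<le> s2"
    and nz: "0 \<notin> W ` path_image (rectpath (Complex t1 s1) (Complex t2 s2))"
  shows "winding_number (W \<circ> rectpath (Complex t1 s1) (Complex t2 s2)) 0 =
    winding_number (W \<circ> linepath (Complex t1 s1) (Complex t2 s1)) 0
    + winding_number (W \<circ> linepath (Complex t2 s1) (Complex t2 s2)) 0
    - winding_number (W \<circ> linepath (Complex t1 s2) (Complex t2 s2)) 0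
    - winding_number (W \<circ> linepath (Complex t1 s1) (Complex t1 s2)) 0"
proof -
  let ?l = "\<lambda>a b. W \<circ> linepath a b"
  have p: "path (?l a b)" for a b
    by (intro path_continuous_image continuous_on_subset[OF W]) auto
  have rev: "?l b a = reversepath (?l a b)" for a b
    by (simp add: path_compose_reversepath[symmetric])
  have im: "path_image (?l a b) = W ` closed_segment a b" for a b
    by (simp add: path_image_compose)
  have eq: "W \<circ> rectpath (Complex t1 s1) (Complex t2 s2) =
    ?l (Complex t1 s1) (Complex t2 s1) +++ ?l (Complex t2 s1) (Complex t2 s2) +++
    reversepath (?l (Complex t1 s2) (Complex t2 s2)) +++ reversepath (?l (Complex t1 s1) (Complex t1 s2))"
    unfolding rectpath_def Let_def path_compose_join rev[symmetric] by simp
  have "path_image (rectpath (Complex t1 s1) (Complex t2 s2)) =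
    closed_segment (Complex t1 s1) (Complex t2 s1) \<union> closed_segment (Complex t2 s1) (Complex t2 s2) \<union>
    closed_segment (Complex t1 s2) (Complex t2 s2) \<union> closed_segment (Complex t1 s1) (Complex t1 s2)"
    by (simp add: rectpath_def Let_def path_image_join Un_assoc
        closed_segment_commute[of "Complex t2 s2" "Complex t1 s2"]
        closed_segment_commute[of "Complex t1 s2" "Complex t1 s1"])
  with nz have n: "0 \<notin> path_image (?l (Complex t1 s1) (Complex t2 s1))"
    "0 \<notin> path_image (?l (Complex t2 s1) (Complex t2 s2))"
    "0 \<notin> path_image (?l (Complex t1 s2) (Complex t2 s2))"
    "0 \<notin> path_image (?l (Complex t1 s1) (Complex t1 s2))"
    unfolding im by auto
  show ?thesis
    unfolding eq using p n
    by (subst winding_number_join winding_number_reversepath;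
        simp add: path_image_join pathfinish_compose pathstart_compose)+
qed

section \<open>Sums over ordered pairs of strands\<close>

definition strand_pairs :: "nat \<Rightarrow> (nat \<times> nat) set" where
  "strand_pairs n = (SIGMA k:{1..n}. {1..n} - {k})"

lemma finite_strand_pairs [simp]: "finite (strand_pairs n)"
  by (simp add: strand_pairs_def)

lemma strand_pairs_iff [simp]: "(k, k') \<in> strand_pairs n \<longleftrightarrow> k \<in> {1..n} \<and> k' \<in> {1..n} \<and> k \<noteq> k'"
  by (auto simp: strand_pairs_def)

lemma Cross_pairs: "Cross n x = (\<Sum>(k, k')\<in>strand_pairs n. real_winding (\<lambda>t. x k t - x k' t))"
  unfolding Cross_def strand_pairs_def by (rule sum.Sigma) auto

text \<open>A permutation of the strands permutes the ordered pairs of distinct strands. This is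
  behind both cancellations below: under a shift of the period, and between the vertical
  sides.\<close>

lemma sum_strand_pairs_permute:
  assumes \<sigma>: "\<sigma> permutes {1..n}"
  shows "(\<Sum>(k, k')\<in>strand_pairs n. f (\<sigma> k) (\<sigma> k')) = (\<Sum>(k, k')\<in>strand_pairs n. f k k')"
proof -
  have inj: "inj_on (map_prod \<sigma> \<sigma>) (strand_pairs n)"
    using permutes_inj[OF \<sigma>] by (auto simp: inj_on_def inj_def)
  have sub: "map_prod \<sigma> \<sigma> ` strand_pairs n \<subseteq> strand_pairs n"
    using permutes_in_image[OF \<sigma>] permutes_inj[OF \<sigma>] by (auto simp del: atLeastAtMost_iff simp: inj_def)
  have "bij_betw (map_prod \<sigma> \<sigma>) (strand_pairs n) (strand_pairs n)"
    unfolding bij_betw_def using inj endo_inj_surj[OF finite_strand_pairs sub inj] by blast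
  from sum.reindex_bij_betw[OF this, of "\<lambda>(k, k'). f k k'"]
  show ?thesis by (simp add: split_beta)
qed

text \<open>For one pair, passing from \<open>[0, 1]\<close> to \<open>[a, a + 1]\<close> adds the
  winding over \<open>[1, 1 + a]\<close> and removes that over \<open>[0, a]\<close>. The former is
  the winding of the permuted pair over \<open>[0, a]\<close>, so the corrections cancel in the
  sum.\<close>

lemma Cross_shift:
  assumes x: "x \<in> braids n" and a: "0 \<le> a" "a \<le> 1"
  shows "(\<Sum>(k, k')\<in>strand_pairs n. real_winding (\<lambda>\<tau>. x k (a + \<tau>) - x k' (a + \<tau>))) = Cross n x"
proof -
  obtain \<sigma> where \<sigma>: "\<sigma> permutes {1..n}" and x\<sigma>: "\<And>k t. k \<in> {1..n} \<Longrightarrow> x k (t + 1) = x (\<sigma> k) t"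
    using x by (auto simp: braids_def singular_braids_def)
  define w where "w k k' b = real_winding (\<lambda>\<tau>. x k (b * \<tau>) - x k' (b * \<tau>))" for k k' b
  have eq: "real_winding (\<lambda>\<tau>. x k (a + \<tau>) - x k' (a + \<tau>)) =
      real_winding (\<lambda>t. x k t - x k' t) + (w (\<sigma> k) (\<sigma> k') a - w k k' a)"
    if k: "k \<in> {1..n}" "k' \<in> {1..n}" "k \<noteq> k'" for k k'
  proof -
    \<comment> \<open>Time is doubled so that \<open>[0, 2]\<close>, which contains
      \<open>[a, a + 1]\<close>, becomes the unit interval of a path and all windings are those of
      subpaths.\<close>
    define g where "g \<tau> = x k (2 * \<tau>) - x k' (2 * \<tau>)" for \<tau>
    have c: "continuous_on UNIV (x k)" "continuous_on UNIV (x k')"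
      using x k by (auto simp: braids_def singular_braids_def)
    have g: "path g"
      unfolding path_def g_def
      by (intro continuous_intros continuous_on_compose2[OF c(1)] continuous_on_compose2[OF c(2)]) auto
    have nz: "x k t \<noteq> x k' t" for t
      using x k by (auto simp: braids_def)
    have g0: "0 \<notin> path_image g"
      using nz by (auto simp: path_image_def g_def)
    have s1: "subpath 0 (1/2) g = (\<lambda>t. x k t - x k' t)"
      and s3: "subpath 0 (a/2) g = (\<lambda>\<tau>. x k (a * \<tau>) - x k' (a * \<tau>))"
      by (auto simp: subpath_def g_def fun_eq_iff field_simps)
    have s2: "subpath (a/2) ((1+a)/2) g = (\<lambda>\<tau>. x k (a + \<tau>) - x k' (a + \<tau>))"
    proof
      fix \<tau>
      have "2 * (((1 + a) / 2 - a / 2) * \<tau> + a / 2) = a + \<tau>" by (simp add: field_simps)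
      then show "subpath (a/2) ((1+a)/2) g \<tau> = x k (a + \<tau>) - x k' (a + \<tau>)"
        by (simp only: subpath_def g_def)
    qed
    have s4: "subpath (1/2) ((1+a)/2) g = (\<lambda>\<tau>. x (\<sigma> k) (a * \<tau>) - x (\<sigma> k') (a * \<tau>))"
    proof
      fix \<tau>
      have "2 * (((1 + a) / 2 - 1 / 2) * \<tau> + 1 / 2) = a * \<tau> + 1" by (simp add: field_simps)
      then show "subpath (1/2) ((1+a)/2) g \<tau> = x (\<sigma> k) (a * \<tau>) - x (\<sigma> k') (a * \<tau>)"
        by (simp only: subpath_def g_def x\<sigma>[OF k(1)] x\<sigma>[OF k(2)])
    qed
    have "winding_number (subpath 0 (1/2) g) 0 + winding_number (subpath (1/2) ((1+a)/2) g) 0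
      = winding_number (subpath 0 (a/2) g) 0 + winding_number (subpath (a/2) ((1+a)/2) g) 0"
      using a by (subst (1 2) winding_number_subpath_combine[OF g g0]) auto
    then have "Re (winding_number (subpath 0 (1/2) g) 0) + Re (winding_number (subpath (1/2) ((1+a)/2) g) 0)
      = Re (winding_number (subpath 0 (a/2) g) 0) + Re (winding_number (subpath (a/2) ((1+a)/2) g) 0)"
      by (metis plus_complex.sel(1))
    then show ?thesis
      unfolding s1 s2 s3 s4 w_def real_winding_def by simp
  qed
  have "(\<Sum>(k, k')\<in>strand_pairs n. real_winding (\<lambda>\<tau>. x k (a + \<tau>) - x k' (a + \<tau>))) =
    (\<Sum>p\<in>strand_pairs n. (case p of (k, k') \<Rightarrow> real_winding (\<lambda>t. x k t - x k' t)) +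
      ((case p of (k, k') \<Rightarrow> w (\<sigma> k) (\<sigma> k') a) - (case p of (k, k') \<Rightarrow> w k k' a)))"
    by (rule sum.cong) (auto simp: eq)
  also have "\<dots> = Cross n x"
    unfolding sum.distrib sum_subtractf Cross_pairs sum_strand_pairs_permute[OF \<sigma>, of "\<lambda>k k'. w k k' a"]
    by simp
  finally show ?thesis .
qed

text \<open>The permutation closing a braid may depend on \<open>s\<close>. Where the
  \<open>y k\<close> are distinct, the index \<open>j\<close> with \<open>z k s = y j s\<close> is
  unique, so the sets of \<open>s\<close> belonging to the different \<open>j\<close> are disjoint,
  closed and finite in number; connectedness of the interval leaves only one.\<close>

lemma locally_constant_permutation:
  fixes y z :: "nat \<Rightarrow> real \<Rightarrow> complex"
  assumes c: "\<And>k. k \<in> {1..n} \<Longrightarrow> continuous_on {s1..s2} (y k)" "\<And>k. k \<in> {1..n} \<Longrightarrow> continuous_on {s1..s2} (z k)"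
    and d: "\<And>k k' s. k \<in> {1..n} \<Longrightarrow> k' \<in> {1..n} \<Longrightarrow> k \<noteq> k' \<Longrightarrow> s \<in> {s1..s2} \<Longrightarrow> y k s \<noteq> y k' s"
    and \<sigma>: "\<And>s. \<exists>\<sigma>. \<sigma> permutes {1..n} \<and> (\<forall>k\<in>{1..n}. z k s = y (\<sigma> k) s)" and le: "s1 \<le> s2"
  shows "\<exists>\<sigma>. \<sigma> permutes {1..n} \<and> (\<forall>k\<in>{1..n}. \<forall>s\<in>{s1..s2}. z k s = y (\<sigma> k) s)"
proof -
  obtain \<sigma> where s: "\<sigma> permutes {1..n}" "\<forall>k\<in>{1..n}. z k s1 = y (\<sigma> k) s1" using \<sigma> by blast
  have "z k s = y (\<sigma> k) s" if k: "k \<in> {1..n}" and sI: "s \<in> {s1..s2}" for k s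
  proof (rule ccontr)
    assume neq: "z k s \<noteq> y (\<sigma> k) s"
    have sk: "\<sigma> k \<in> {1..n}" using s(1) k by (simp only: permutes_in_image)
    define C where "C j = {s\<in>{s1..s2}. z k s = y j s}" for j
    have cl: "closed (C j)" if "j \<in> {1..n}" for j
    proof -
      have "closed {s\<in>{s1..s2}. z k s - y j s = 0}"
        by (intro continuous_closed_preimage_constant continuous_intros c k that closed_real_atLeastAtMost)
      then show ?thesis by (simp add: C_def)
    qed
    define B where "B = (\<Union>j\<in>{1..n} - {\<sigma> k}. C j)"
    have clB: "closed B" unfolding B_def using cl by (intro closed_UN) auto
    have cover: "{s1..s2} \<subseteq> C (\<sigma> k) \<union> B"
    proof
      fix r assume r: "r \<in> {s1..s2}"
      obtain \<tau> where \<tau>: "\<tau> permutes {1..n}" "\<forall>k\<in>{1..n}. z k r = y (\<tau> k) r" using \<sigma> by blast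
      have "\<tau> k \<in> {1..n}" using \<tau>(1) k by (simp only: permutes_in_image)
      with \<tau>(2) k r show "r \<in> C (\<sigma> k) \<union> B" by (auto simp: C_def B_def)
    qed
    have disj: "C (\<sigma> k) \<inter> B \<inter> {s1..s2} = {}"
      using d sk by (force simp: C_def B_def)
    have "C (\<sigma> k) \<inter> {s1..s2} \<noteq> {}" using s(2) k le by (auto simp: C_def)
    moreover have "s \<in> B" using subsetD[OF cover sI] neq by (simp add: C_def)
    then have "B \<inter> {s1..s2} \<noteq> {}" using sI by blast
    moreover have "connected {s1..s2}" by simp
    ultimately show False
      using cl[OF sk] clB cover disj unfolding connected_closed by blast
  qed
  with s show ?thesis by blast
qed

section \<open>Comparison of two nonsingular levels\<close>

text \<open>The Cauchy-Riemann structure enters through \<open>hl\<close> alone; the rest is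
  counting. Nonsingularity at \<open>s1\<close> gives each difference a nonzero value, so its zeros
  in the period rectangle are finite in number and a generic \<open>a\<close> exists.\<close>

lemma Cross_monotone:
  assumes sb: "\<And>s. (\<lambda>k. u k s) \<in> singular_braids n"
    and cs: "\<And>k t. k \<in> {1..n} \<Longrightarrow> continuous_on UNIV (\<lambda>s. u k s t)"
    and hl: "\<And>k k'. k \<in> {1..n} \<Longrightarrow> k' \<in> {1..n} \<Longrightarrow> k \<noteq> k' \<Longrightarrow> holomorphic_like (\<lambda>z. u k (Im z) (Re z) - u k' (Im z) (Re z))"
    and less: "s1 < s2" and b: "(\<lambda>k. u k s1) \<in> braids n" "(\<lambda>k. u k s2) \<in> braids n"
  shows "Cross n (\<lambda>k. u k s2) \<le> Cross n (\<lambda>k. u k s1)"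
    and "k \<in> {1..n} \<Longrightarrow> k' \<in> {1..n} \<Longrightarrow> k \<noteq> k' \<Longrightarrow> s1 < s0 \<Longrightarrow> s0 < s2 \<Longrightarrow> u k s0 t0 = u k' s0 t0 \<Longrightarrow>
      Cross n (\<lambda>k. u k s2) < Cross n (\<lambda>k. u k s1)"
proof -
  define coll where "coll s t \<longleftrightarrow> (\<exists>k\<in>{1..n}. \<exists>k'\<in>{1..n}. k \<noteq> k' \<and> u k s t = u k' s t)" for s t
  have per1: "coll s (t + 1) \<longleftrightarrow> coll s t" for s t
  proof -
    obtain \<sigma> where \<sigma>: "\<sigma> permutes {1..n}" "\<And>k t. k \<in> {1..n} \<Longrightarrow> u k s (t + 1) = u (\<sigma> k) s t"
      using sb[of s] by (auto simp: singular_braids_def)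
    have "coll s (t + 1) \<longleftrightarrow> (\<exists>k\<in>{1..n}. \<exists>k'\<in>{1..n}. \<sigma> k \<noteq> \<sigma> k' \<and> u (\<sigma> k) s t = u (\<sigma> k') s t)"
      unfolding coll_def using \<sigma>(2) permutes_inj[OF \<sigma>(1)] by (auto simp: inj_eq)
    also have "\<dots> \<longleftrightarrow> (\<exists>k\<in>\<sigma> ` {1..n}. \<exists>k'\<in>\<sigma> ` {1..n}. k \<noteq> k' \<and> u k s t = u k' s t)"
      by simp
    finally show ?thesis unfolding coll_def permutes_image[OF \<sigma>(1)] .
  qed
  have per: "coll s (t + of_int m) \<longleftrightarrow> coll s t" for s t m
  proof (induction m rule: int_induct[of _ 0])
    case (step1 i)
    then show ?case using per1[of s "t + of_int i"] by (simp add: add.assoc)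
  next
    case (step2 i)
    then show ?case using per1[of s "t + of_int (i - 1)"] by (simp add: add.assoc)
  qed simp
  have nocoll: "u k s t \<noteq> u k' s t" if "\<not> coll s t" "(k, k') \<in> strand_pairs n" for k k' s t
    using that unfolding coll_def strand_pairs_iff by blast
  define W where "W k k' z = u k (Im z) (Re z) - u k' (Im z) (Re z)" for k k' z
  have W: "holomorphic_like (W k k')" if "(k, k') \<in> strand_pairs n" for k k'
    using hl that unfolding W_def[abs_def] by simp
  define Z where "Z p = {z \<in> cbox (Complex 0 s1) (Complex 1 s2). W (fst p) (snd p) z = 0}" for p
  have good: "\<not> coll s1 t" "\<not> coll s2 t" for t
    using b by (auto simp: braids_def coll_def)
  have "finite (Z p)" if "p \<in> strand_pairs n" for p
    unfolding Z_def
  proof (rule holomorphic_like_finite_zeros[of _ _ "Complex 0 s1"])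
    show "holomorphic_like (W (fst p) (snd p))" using that W by (cases p) simp
    show "W (fst p) (snd p) (Complex 0 s1) \<noteq> 0"
      using that nocoll[OF good(1)[of 0]] by (cases p) (simp add: W_def)
  qed auto
  then have "finite (\<Union>p\<in>strand_pairs n. Re ` Z p)" by auto
  moreover have "infinite {0..1::real}" by (simp add: infinite_Icc_iff)
  \<comment> \<open>The vertical sides of the rectangle have to avoid the collisions, so the period \<open>[0, 1]\<close> is
      replaced by \<open>[a, a + 1]\<close> for a generic \<open>a\<close>.\<close>
  ultimately obtain a where a: "a \<in> {0..1}" "a \<notin> (\<Union>p\<in>strand_pairs n. Re ` Z p)"
    by (meson finite_subset subsetI)
  have clean: "\<not> coll s a" if "s \<in> {s1..s2}" for s
  proof
    assume "coll s a"
    then obtain k k' where k: "(k, k') \<in> strand_pairs n" "u k s a = u k' s a" unfolding coll_def strand_pairs_iff by blast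
    then have "Complex a s \<in> Z (k, k')" using a(1) that by (auto simp: Z_def W_def in_cbox_complex_iff)
    with a(2) k(1) show False by force
  qed
  have clean1: "\<not> coll s (a + 1)" if "s \<in> {s1..s2}" for s
    using clean[OF that] per1 by simp
  obtain \<sigma> where \<sigma>: "\<sigma> permutes {1..n}"
    and u\<sigma>: "\<And>k s. k \<in> {1..n} \<Longrightarrow> s \<in> {s1..s2} \<Longrightarrow> u k s (a + 1) = u (\<sigma> k) s a"
  proof -
    have "\<exists>\<sigma>. \<sigma> permutes {1..n} \<and> (\<forall>k\<in>{1..n}. \<forall>s\<in>{s1..s2}. u k s (a + 1) = u (\<sigma> k) s a)"
    proof (rule locally_constant_permutation)
      fix s show "\<exists>\<sigma>. \<sigma> permutes {1..n} \<and> (\<forall>k\<in>{1..n}. u k s (a + 1) = u (\<sigma> k) s a)"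
        using sb[of s] by (auto simp: singular_braids_def)
    next
      fix k k' s assume "k \<in> {1..n}" "k' \<in> {1..n}" "k \<noteq> k'" "s \<in> {s1..s2}"
      then show "u k s a \<noteq> u k' s a" using clean unfolding coll_def by blast
    qed (use less cs in \<open>auto intro: continuous_on_subset\<close>)
    then show ?thesis using that by blast
  qed
  define \<gamma> where "\<gamma> = rectpath (Complex a s1) (Complex (a + 1) s2)"
  have nz: "W k k' z \<noteq> 0" if k: "(k, k') \<in> strand_pairs n" and z: "z \<in> path_image \<gamma>" for k k' z
  proof -
    have "Re z \<in> {a, a + 1} \<and> Im z \<in> {s1..s2} \<or> Im z \<in> {s1, s2}"
      using z less unfolding \<gamma>_def by (subst (asm) path_image_rectpath) auto
    then have "\<not> coll (Im z) (Re z)" using good clean clean1 by auto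
    then show ?thesis using nocoll k by (simp add: W_def)
  qed
  \<comment> \<open>Winding along the left side. On the right side the pair \<open>(k, k')\<close>
    follows \<open>(\<sigma> k, \<sigma> k')\<close> on the left, so the sides cancel after
    summation, not pair by pair.\<close>
  define L where "L k k' = Re (winding_number (W k k' \<circ> linepath (Complex a s1) (Complex a s2)) 0)" for k k'
  define h where "h s p = (case p of (k, k') \<Rightarrow> real_winding (\<lambda>\<tau>. u k s (a + \<tau>) - u k' s (a + \<tau>)))" for s p
  have wind: "Re (winding_number (W k k' \<circ> \<gamma>) 0) = h s1 (k, k') - h s2 (k, k') + (L (\<sigma> k) (\<sigma> k') - L k k')"
    if k: "(k, k') \<in> strand_pairs n" for k k'
  proof -
    have cW: "continuous_on UNIV (W k k')" using W[OF k] by (simp add: holomorphic_like_def)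
    have bottom: "W k k' \<circ> linepath (Complex a s) (Complex (a + 1) s) = (\<lambda>\<tau>. u k s (a + \<tau>) - u k' s (a + \<tau>))" for s
      by (auto simp: fun_eq_iff W_def linepath_def algebra_simps)
    have side: "winding_number (W k k' \<circ> linepath (Complex (a + 1) s1) (Complex (a + 1) s2)) 0
      = winding_number (W (\<sigma> k) (\<sigma> k') \<circ> linepath (Complex a s1) (Complex a s2)) 0"
    proof (rule winding_number_cong)
      fix \<tau> :: real assume \<tau>: "0 \<le> \<tau>" "\<tau> \<le> 1"
      define s where "s = (1 - \<tau>) * s1 + \<tau> * s2"
      have "linepath (Complex b s1) (Complex b s2) \<tau> = Complex b s" for b
        by (simp add: linepath_def complex_eq_iff s_def algebra_simps)
      moreover have "s \<in> {s1..s2}"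
        using \<tau> less convexD_alt[of "{s1..s2}" s1 s2 \<tau>] by (simp add: s_def)
      ultimately show "(W k k' \<circ> linepath (Complex (a + 1) s1) (Complex (a + 1) s2)) \<tau> =
          (W (\<sigma> k) (\<sigma> k') \<circ> linepath (Complex a s1) (Complex a s2)) \<tau>"
        using u\<sigma> k by (simp add: W_def)
    qed
    have "0 \<notin> W k k' ` path_image \<gamma>" using nz[OF k] by force
    from winding_number_compose_rectpath[OF cW _ _ this[unfolded \<gamma>_def]] less
    show ?thesis
      unfolding \<gamma>_def side bottom by (simp add: h_def L_def real_winding_def)
  qed
  have hC: "(\<Sum>p\<in>strand_pairs n. h s p) = Cross n (\<lambda>k. u k s)" if "(\<lambda>k. u k s) \<in> braids n" for s
    using Cross_shift[OF that, of a] a(1) by (simp add: h_def)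
  have "(\<Sum>(k, k')\<in>strand_pairs n. Re (winding_number (W k k' \<circ> \<gamma>) 0)) =
    (\<Sum>p\<in>strand_pairs n. h s1 p - h s2 p + ((case p of (k, k') \<Rightarrow> L (\<sigma> k) (\<sigma> k')) - (case p of (k, k') \<Rightarrow> L k k')))"
    by (rule sum.cong) (auto simp: wind)
  also have "\<dots> = Cross n (\<lambda>k. u k s1) - Cross n (\<lambda>k. u k s2)"
    unfolding sum.distrib sum_subtractf hC[OF b(1)] hC[OF b(2)] sum_strand_pairs_permute[OF \<sigma>, of L] by simp
  finally have total: "(\<Sum>(k, k')\<in>strand_pairs n. Re (winding_number (W k k' \<circ> \<gamma>) 0)) =
    Cross n (\<lambda>k. u k s1) - Cross n (\<lambda>k. u k s2)" .
  have nonneg: "Re (winding_number (W k k' \<circ> \<gamma>) 0) \<ge> 0" if k: "(k, k') \<in> strand_pairs n" for k k'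
    using holomorphic_like_rectangle_winding(1)[OF W[OF k], of "Complex a s1" "Complex (a + 1) s2"]
      nz[OF k] less by (simp add: \<gamma>_def)
  have "(\<Sum>(k, k')\<in>strand_pairs n. Re (winding_number (W k k' \<circ> \<gamma>) 0)) \<ge> 0"
    using nonneg by (intro sum_nonneg) auto
  with total show "Cross n (\<lambda>k. u k s2) \<le> Cross n (\<lambda>k. u k s1)" by simp
  show "Cross n (\<lambda>k. u k s2) < Cross n (\<lambda>k. u k s1)"
    if "k \<in> {1..n}" "k' \<in> {1..n}" "k \<noteq> k'" and s0: "s1 < s0" "s0 < s2" and "u k s0 t0 = u k' s0 t0"
  proof -
    have "coll s0 t0" using that unfolding coll_def by blast
    \<comment> \<open>The integer translate of \<open>t0\<close> in \<open>[a, a + 1)\<close>. The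
      choice of \<open>a\<close> excludes the left endpoint, so the collision lies in the open
      rectangle.\<close>
    define t where "t = t0 + of_int (- \<lfloor>t0 - a\<rfloor>)"
    have "coll s0 t" unfolding t_def using \<open>coll s0 t0\<close> per by blast
    have "a \<le> t" "t < a + 1" unfolding t_def by linarith+
    moreover have "t \<noteq> a" using clean[of s0] s0 \<open>coll s0 t\<close> by auto
    ultimately have box: "Complex t s0 \<in> box (Complex a s1) (Complex (a + 1) s2)"
      using s0 by (simp add: in_box_complex_iff)
    \<comment> \<open>Translating by whole periods permutes the strands, so the pair colliding at
      \<open>t\<close> may differ from the given one.\<close>
    obtain j j' where j: "(j, j') \<in> strand_pairs n" "u j s0 t = u j' s0 t"
      using \<open>coll s0 t\<close> unfolding coll_def strand_pairs_iff by blast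
    have "W j j' (Complex t s0) = 0" using j by (simp add: W_def)
    then have "Re (winding_number (W j j' \<circ> \<gamma>) 0) > 0"
      using holomorphic_like_rectangle_winding(2)[OF W[OF j(1)], of "Complex a s1" "Complex (a + 1) s2", OF _ _ _ box]
        nz[OF j(1)] less by (simp add: \<gamma>_def)
    then have "(\<Sum>(k, k')\<in>strand_pairs n. Re (winding_number (W k k' \<circ> \<gamma>) 0)) > 0"
      using nonneg by (intro sum_pos2[OF _ j(1)]) auto
    with total show ?thesis by simp
  qed
qed

theorem lemma5p4:
  fixes n :: nat
    and J :: "real \<Rightarrow> complex \<Rightarrow> (complex \<Rightarrow>\<^sub>L complex)"
    and H :: "real \<Rightarrow> complex \<Rightarrow> real"
    and u :: "nat \<Rightarrow> real \<Rightarrow> real \<Rightarrow> complex"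
  assumes "n \<ge> 1"
    and "J \<in> acs_families"
    and "H \<in> Hamiltonians"
    and "u \<in> CR_solutions n J H"
  shows "(\<forall>s1 s2. s1 \<le> s2 \<longrightarrow> (\<lambda>k. u k s1) \<in> braids n \<longrightarrow> (\<lambda>k. u k s2) \<in> braids n \<longrightarrow>
            Cross n (\<lambda>k. u k s2) \<le> Cross n (\<lambda>k. u k s1)) \<and>
         (\<forall>k\<in>{1..n}. \<forall>k'\<in>{1..n}. \<forall>s0 t0. k \<noteq> k' \<longrightarrow> u k s0 t0 = u k' s0 t0 \<longrightarrow>
            (\<exists>\<epsilon>0>0. \<forall>\<epsilon>. 0 < \<epsilon> \<and> \<epsilon> \<le> \<epsilon>0 \<longrightarrow>
               (\<lambda>j. u j (s0 - \<epsilon>)) \<in> braids n \<longrightarrow> (\<lambda>j. u j (s0 + \<epsilon>)) \<in> braids n \<longrightarrow>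
               Cross n (\<lambda>j. u j (s0 - \<epsilon>)) > Cross n (\<lambda>j. u j (s0 + \<epsilon>))) \<or>
            (\<forall>s t. u k s t = u k' s t))"
proof -
  have sb: "(\<lambda>k. u k s) \<in> singular_braids n" for s
    using assms(4) by (simp add: CR_solutions_def)
  have cs: "continuous_on UNIV (\<lambda>s. u k s t)" if k: "k \<in> {1..n}" for k t
  proof -
    obtain U' where "\<And>z. ((\<lambda>z. u k (Im z) (Re z)) has_derivative U' z) (at z)"
      by (rule strand_derivative[OF assms(4) k]) blast
    then have "continuous_on UNIV (\<lambda>z. u k (Im z) (Re z))"
      by (meson continuous_at_imp_continuous_on has_derivative_continuous)
    moreover have "continuous_on UNIV (\<lambda>s. Complex t s)"
      unfolding Complex_eq by (intro continuous_intros)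
    ultimately have "continuous_on UNIV (\<lambda>s. u k (Im (Complex t s)) (Re (Complex t s)))"
      by (rule continuous_on_compose2) simp
    then show ?thesis by simp
  qed
  have hl: "holomorphic_like (\<lambda>z. u k (Im z) (Re z) - u k' (Im z) (Re z))"
    if "k \<in> {1..n}" "k' \<in> {1..n}" "k \<noteq> k'" for k k'
    using assms(2-4) that(1,2) by (rule strand_difference_holomorphic_like)
  show ?thesis
  proof (intro conjI allI impI ballI disjI1)
    fix s1 s2 :: real
    assume "s1 \<le> s2" "(\<lambda>k. u k s1) \<in> braids n" "(\<lambda>k. u k s2) \<in> braids n"
    then show "Cross n (\<lambda>k. u k s2) \<le> Cross n (\<lambda>k. u k s1)"
      using Cross_monotone(1)[OF sb cs hl, of s1 s2] by (cases "s1 = s2") auto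
  next
    \<comment> \<open>The first alternative always holds: if \<open>u k\<close> and \<open>u k'\<close> coincide, it is vacuous.\<close>
    fix k k' s0 t0
    assume *: "k \<in> {1..n}" "k' \<in> {1..n}" "k \<noteq> k'" "u k s0 t0 = u k' s0 t0"
    show "\<exists>\<epsilon>0>0. \<forall>\<epsilon>. 0 < \<epsilon> \<and> \<epsilon> \<le> \<epsilon>0 \<longrightarrow>
               (\<lambda>j. u j (s0 - \<epsilon>)) \<in> braids n \<longrightarrow> (\<lambda>j. u j (s0 + \<epsilon>)) \<in> braids n \<longrightarrow>
               Cross n (\<lambda>j. u j (s0 - \<epsilon>)) > Cross n (\<lambda>j. u j (s0 + \<epsilon>))"
    \<comment> \<open>The value \<open>1\<close> is arbitrary: the strict comparison holds for any
      two nonsingular levels with \<open>s0\<close> strictly between them.\<close>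
    proof (intro exI[of _ 1] conjI allI impI)
      fix \<epsilon> :: real
      assume "0 < \<epsilon> \<and> \<epsilon> \<le> 1" "(\<lambda>j. u j (s0 - \<epsilon>)) \<in> braids n" "(\<lambda>j. u j (s0 + \<epsilon>)) \<in> braids n"
      then show "Cross n (\<lambda>j. u j (s0 - \<epsilon>)) > Cross n (\<lambda>j. u j (s0 + \<epsilon>))"
        by (intro Cross_monotone(2)[OF sb cs hl _ _ _ *(1-3) _ _ *(4)]) auto
    qed simp
  qed
qed

end
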